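(* For any $a\in\mathbb{R}$ there exists a solution $H=H(\xi)$, defined for all $\xi\in\mathbb{R}$, of $$\left(\frac{d^{3}H}{d\xi^{3}}+\xi^{2}+a\right)H^{3}=1$$ satisfying $$H(\xi)\sim\frac{1}{|\xi|^{2/3}}\quad\text{as}\quad |\xi|\to\infty .$$
   Context: $f\sim g$ as $|\xi|\to\infty$ means $f/g\to 1$ both as $\xi\to+\infty$ and as $\xi\to-\infty$. *)

theory Defs
  imports "HOL-Analysis.Analysis" "HOL-Library.Landau_Symbols"
begin

text \<open>
  Since \<^const>\<open>deriv\<close> is total, the existence of the first three derivatives is required explicitly.
  Continuity of the third one need not be: by the equation, H vanishes nowhere and
  the third derivative is the continuous function \<open>1 / H\<^sup>3 - \<xi>\<^sup>2 - a\<close>.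
\<close>

definition is_global_solution :: "real \<Rightarrow> (real \<Rightarrow> real) \<Rightarrow> bool" where
  "is_global_solution a H \<longleftrightarrow>
     (\<forall>k<3. \<forall>\<xi>. ((deriv ^^ k) H) differentiable (at \<xi>)) \<and>
     (\<forall>\<xi>. ((deriv ^^ 3) H \<xi> + \<xi>\<^sup>2 + a) * (H \<xi>) ^ 3 = 1)"

end

theory Submission
  imports Defs
begin

text \<open>
  With \<open>t = - \<xi>\<close> and \<open>Y t = H (- t)\<close> the equation becomes \<open>Y''' = t\<^sup>2 + a - 1 / Y ^ 3\<close>. Two features of it carry
  the whole proof.

  First, the right-hand side is increasing in \<open>Y\<close>. Two solutions with the same value and slope at a
  point therefore separate to the right of it at least quadratically, at a rate given by the difference of their second
  derivatives, and shooting in that one parameter solves the boundary value problem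
  on \<open>[-R, R]\<close> with \<open>Y\<close> and \<open>Y'\<close> prescribed at the left end and \<open>Y\<close> at the right end
  (\<open>third_order_bvp\<close>). For this the singular term is first truncated at a small height \<open>\<delta>\<close>.

  Second, the third derivative is skew-symmetric. If \<open>h\<close> is a comparison function and \<open>w = Y - h\<close>
  vanishes at both ends, with \<open>w' = 0\<close> at the left end, then the integral of \<open>w''' * w\<close> is nonpositive
  (\<open>skew_energy_identity\<close>), while pointwise \<open>w''' * w = (t\<^sup>2 + a - h''' - 1 / Y ^ 3) * (Y - h)\<close>
  is the product of a monotone function of \<open>Y\<close> and \<open>Y - h\<close>. If \<open>h\<close> decays like \<open>\<bar>t\<bar> powr (-2/3)\<close>, solves
  the equation up to a bounded error, and satisfies \<open>t\<^sup>2 + a - h''' \<ge> 1\<close> everywhere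
  (\<open>comparison_profile_exists\<close>), then this density is bounded below by an integrable function and
  controls both \<open>Y\<close> and \<open>1 / Y ^ 3\<close> (\<open>energy_controls_locally\<close>, \<open>energy_controls_gap_far\<close>). So its
  integral is bounded independently of \<open>R\<close> and \<open>\<delta>\<close>.

  Everything else follows from this one bound. Control of the local integrals of \<open>Y\<close> and of \<open>1 / Y ^ 3\<close>
  bounds \<open>Y\<close>, \<open>Y'\<close>, \<open>Y''\<close> locally by interpolation and keeps \<open>Y\<close> away from \<open>0\<close>, because \<open>1 / Y ^ 3\<close> has
  a large integral near any point where a Lipschitz function almost vanishes; in particular the truncation
  is inactive for small \<open>\<delta>\<close> (\<open>untruncated_solution_exists\<close>). Far from the origin a
  deviation of \<open>Y\<close> from \<open>\<bar>t\<bar> powr (-2/3)\<close> by a fixed factor, which by interpolation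
  persists over the natural length \<open>\<bar>t\<bar> powr (-8/9)\<close>, would cost an energy of order
  \<open>\<bar>t\<bar> powr (4/9)\<close>; hence the asymptotics hold uniformly in \<open>R\<close> (\<open>approx_solution_asymptotics\<close>). Finally
  \<open>R\<close> tends to infinity along a subsequence for which the data at \<open>0\<close> converge
  (\<open>global_solution_exists\<close>).
\<close>

section \<open>Initial value problems\<close>

lemma nondecreasing_on_interval:
  fixes f :: "real \<Rightarrow> real"
  assumes deriv: "\<And>x. x \<in> {a..b} \<Longrightarrow> (f has_real_derivative f' x) (at x within {a..b})"
    and nonneg: "\<And>x. x \<in> {s..t} \<Longrightarrow> 0 \<le> f' x"
    and "s \<in> {a..b}" "t \<in> {a..b}" "s \<le> t"
  shows "f s \<le> f t"
proof (cases "s = t")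
  case False
  then have "s < t" using assms by simp
  have "\<exists>x\<in>{s<..<t}. f t - f s = f' x * (t - s)"
  proof (rule mvt_simple[OF \<open>s < t\<close>, of f "\<lambda>x h. f' x * h"])
    fix x assume "s \<le> x" "x \<le> t"
    then have "(f has_real_derivative f' x) (at x within {s..t})"
      using assms by (intro DERIV_subset[OF deriv]) auto
    then show "(f has_derivative (\<lambda>h. f' x * h)) (at x within {s..t})"
      by (simp add: has_field_derivative_def)
  qed
  then show ?thesis using nonneg \<open>s < t\<close>
    by (metis diff_ge_0_iff_ge greaterThanLessThan_subseteq_atLeastAtMost_iff mult_nonneg_nonneg order.refl subsetD less_imp_le)
qed simp

text \<open>
  The squared norm changes at a logarithmic rate of at most \<open>2 * L\<close>; the estimate runs in both
  directions of time, because solutions on \<open>[-R, R]\<close> are compared from their data at \<open>0\<close>.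
\<close>

lemma gronwall_norm:
  fixes d :: "real \<Rightarrow> 'a::real_inner"
  assumes deriv: "\<And>t. t \<in> {a..b} \<Longrightarrow> (d has_vector_derivative d' t) (at t within {a..b})"
    and bound: "\<And>t. t \<in> {a..b} \<Longrightarrow> norm (d' t) \<le> L * norm (d t)"
    and s: "s \<in> {a..b}" and t: "t \<in> {a..b}"
  shows "norm (d t) \<le> exp (L * \<bar>t - s\<bar>) * norm (d s)"
proof -
  define E where "E = (\<lambda>t. d t \<bullet> d t)"
  have dE: "(E has_real_derivative 2 * (d t \<bullet> d' t)) (at t within {a..b})" if "t \<in> {a..b}" for t
    using has_derivative_inner[OF deriv[OF that, unfolded has_vector_derivative_def]
        deriv[OF that, unfolded has_vector_derivative_def]]
    unfolding E_def has_field_derivative_def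
    by (rule has_derivative_eq_rhs) (auto simp: inner_commute algebra_simps)
  have Eb: "\<bar>2 * (d t \<bullet> d' t)\<bar> \<le> 2 * L * E t" if "t \<in> {a..b}" for t
  proof -
    have "\<bar>d t \<bullet> d' t\<bar> \<le> norm (d t) * norm (d' t)" by (rule Cauchy_Schwarz_ineq2)
    also have "\<dots> \<le> norm (d t) * (L * norm (d t))" using bound[OF that] by (intro mult_left_mono) auto
    also have "\<dots> = L * E t" by (simp add: E_def power2_norm_eq_inner[symmetric] power2_eq_square)
    finally show ?thesis by simp
  qed
  have E: "E t \<le> exp (2 * L * \<bar>t - s\<bar>) * E s"
  proof (cases "s \<le> t")
    case True
    have "- (exp (- 2 * L * s) * E s) \<le> - (exp (- 2 * L * t) * E t)"
    proof (rule nondecreasing_on_interval[OF _ _ s t True])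
      fix x assume "x \<in> {a..b}"
      then show "((\<lambda>x. - (exp (- 2 * L * x) * E x)) has_real_derivative
          exp (- 2 * L * x) * (2 * L * E x - 2 * (d x \<bullet> d' x))) (at x within {a..b})"
        by (auto intro!: derivative_eq_intros dE simp: algebra_simps)
    next
      fix x assume "x \<in> {s..t}"
      with s t have "x \<in> {a..b}" by auto
      from Eb[OF this] show "0 \<le> exp (- 2 * L * x) * (2 * L * E x - 2 * (d x \<bullet> d' x))" by auto
    qed
    then have "exp (2 * L * t) * (exp (- 2 * L * t) * E t) \<le> exp (2 * L * t) * (exp (- 2 * L * s) * E s)"
      by (intro mult_left_mono) auto
    then show ?thesis using True by (simp add: mult.assoc[symmetric] exp_add[symmetric] right_diff_distrib)
  next
    case False
    then have "t \<le> s" by simp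
    have "exp (2 * L * t) * E t \<le> exp (2 * L * s) * E s"
    proof (rule nondecreasing_on_interval[OF _ _ t s \<open>t \<le> s\<close>])
      fix x assume "x \<in> {a..b}"
      then show "((\<lambda>x. (exp (2 * L * x) * E x)) has_real_derivative
          exp (2 * L * x) * (2 * L * E x + 2 * (d x \<bullet> d' x))) (at x within {a..b})"
        by (auto intro!: derivative_eq_intros dE simp: algebra_simps)
    next
      fix x assume "x \<in> {t..s}"
      with s t have "x \<in> {a..b}" by auto
      from Eb[OF this] show "0 \<le> exp (2 * L * x) * (2 * L * E x + 2 * (d x \<bullet> d' x))" by auto
    qed
    then have "exp (- 2 * L * t) * (exp (2 * L * t) * E t) \<le> exp (- 2 * L * t) * (exp (2 * L * s) * E s)"
      by (intro mult_left_mono) auto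
    then show ?thesis using False by (simp add: mult.assoc[symmetric] exp_add[symmetric] right_diff_distrib)
  qed
  have "(norm (d t))\<^sup>2 \<le> (exp (L * \<bar>t - s\<bar>) * norm (d s))\<^sup>2"
    using E by (simp add: E_def power_mult_distrib power2_norm_eq_inner exp_double[symmetric] mult.assoc)
  then show ?thesis by (rule power2_le_imp_le) simp
qed

text \<open>
  The unknown is \<open>u t = exp (- K * (t - a)) *\<^sub>R z t\<close> instead of \<open>z\<close>: in the sup norm of \<open>u\<close> the
  integral operator contracts with ratio \<open>\<bar>L\<bar> / K \<le> 1/2\<close> on the whole interval, however long, so no
  gluing of short-time solutions is needed. Composing with the clamp \<open>c\<close> onto \<open>[a, b]\<close> turns
  continuous functions on the interval into bounded continuous functions on the line, where
  the Banach fixed point theorem applies.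
\<close>

lemma picard_lindelof:
  fixes f :: "real \<Rightarrow> 'a::banach \<Rightarrow> 'a"
  assumes "a \<le> b"
    and cont: "continuous_on ({a..b} \<times> UNIV) (\<lambda>(t, x). f t x)"
    and lip: "\<And>t x y. t \<in> {a..b} \<Longrightarrow> norm (f t x - f t y) \<le> L * norm (x - y)"
  obtains z where "z a = z0"
    "\<And>t. t \<in> {a..b} \<Longrightarrow> (z has_vector_derivative f t (z t)) (at t within {a..b})"
proof -
  define K where "K = 2 * \<bar>L\<bar> + 1"
  have K: "K > 0" "\<bar>L\<bar> \<le> K / 2" by (auto simp: K_def)
  define c where "c = (\<lambda>t. max a (min b t))"
  have c: "c t \<in> {a..b}" for t using \<open>a \<le> b\<close> by (auto simp: c_def)
  have c_id: "c t = t" if "t \<in> {a..b}" for t using that by (auto simp: c_def)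
  have cc: "continuous_on UNIV c" unfolding c_def by (intro continuous_intros)
  define I where "I = (\<lambda>(u :: real \<Rightarrow>\<^sub>C 'a) t. z0 + integral {a..t} (\<lambda>s. f s (exp (K * (s - a)) *\<^sub>R u s)))"
  define T where "T = (\<lambda>u t. exp (- K * (c t - a)) *\<^sub>R I u (c t))"
  have cf: "continuous_on {a..b} (\<lambda>s. f s (exp (K * (s - a)) *\<^sub>R apply_bcontfun u s))" for u
  proof -
    have "continuous_on {a..b} (\<lambda>s. (s, exp (K * (s - a)) *\<^sub>R apply_bcontfun u s))"
      by (intro continuous_intros continuous_on_subset[OF continuous_on_apply_bcontfun]) auto
    from continuous_on_compose2[OF cont this] show ?thesis by auto
  qed
  have int_f: "(\<lambda>s. f s (exp (K * (s - a)) *\<^sub>R apply_bcontfun u s)) integrable_on {a..t}" if "t \<in> {a..b}" for u t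
    by (rule integrable_continuous_real, rule continuous_on_subset[OF cf]) (use that in auto)
  have cI: "continuous_on {a..b} (I u)" for u
    unfolding I_def
    by (intro continuous_intros indefinite_integral_continuous_1 int_f) (use \<open>a \<le> b\<close> in auto)
  have T_bc: "T u \<in> bcontfun" for u
  proof -
    have "compact ((\<lambda>t. exp (- K * (t - a)) *\<^sub>R I u t) ` {a..b})"
      by (intro compact_continuous_image continuous_intros cI) auto
    then have "bounded ((\<lambda>t. exp (- K * (t - a)) *\<^sub>R I u t) ` {a..b})" by (rule compact_imp_bounded)
    then obtain B where B: "\<And>t. t \<in> {a..b} \<Longrightarrow> norm (exp (- K * (t - a)) *\<^sub>R I u t) \<le> B"
      unfolding bounded_iff by blast
    show ?thesis
    proof (rule bcontfun_normI)
      show "continuous_on UNIV (T u)"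
        unfolding T_def
        by (intro continuous_intros cc continuous_on_compose2[OF cI cc]) (auto simp: c[simplified])
      show "norm (T u t) \<le> B" for t unfolding T_def by (rule B[OF c])
    qed
  qed
  have contr: "dist (Bcontfun (T u)) (Bcontfun (T v)) \<le> 1/2 * dist u v" for u v
  proof (rule dist_bound)
    fix t
    define s where "s = c t"
    have s: "s \<in> {a..b}" unfolding s_def by (rule c)
    have exp_int: "((\<lambda>r. exp (K * (r - a))) has_integral (exp (K * (s - a)) / K - exp (K * (a - a)) / K)) {a..s}"
      by (rule fundamental_theorem_of_calculus)
         (use s K in \<open>auto intro!: derivative_eq_intros simp: has_real_derivative_iff_has_vector_derivative[symmetric]\<close>)
    have "norm (I u s - I v s) = norm (integral {a..s} (\<lambda>r. f r (exp (K * (r - a)) *\<^sub>R u r) - f r (exp (K * (r - a)) *\<^sub>R v r)))"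
      unfolding I_def using Henstock_Kurzweil_Integration.integral_diff[OF int_f[OF s, of u] int_f[OF s, of v]] by simp
    also have "\<dots> \<le> integral {a..s} (\<lambda>r. \<bar>L\<bar> * dist u v * exp (K * (r - a)))"
    proof (rule integral_norm_bound_integral)
      show "(\<lambda>r. f r (exp (K * (r - a)) *\<^sub>R u r) - f r (exp (K * (r - a)) *\<^sub>R v r)) integrable_on {a..s}"
        by (intro Henstock_Kurzweil_Integration.integrable_diff int_f s)
      show "(\<lambda>r. \<bar>L\<bar> * dist u v * exp (K * (r - a))) integrable_on {a..s}"
        by (intro integrable_continuous_real continuous_intros)
      fix r assume r: "r \<in> {a..s}"
      then have "r \<in> {a..b}" using s by auto
      then have "norm (f r (exp (K * (r - a)) *\<^sub>R u r) - f r (exp (K * (r - a)) *\<^sub>R v r))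
          \<le> L * norm (exp (K * (r - a)) *\<^sub>R u r - exp (K * (r - a)) *\<^sub>R v r)" by (rule lip)
      also have "\<dots> = L * (exp (K * (r - a)) * dist (u r) (v r))"
        by (simp add: scaleR_right_diff_distrib[symmetric] dist_norm)
      also have "\<dots> \<le> \<bar>L\<bar> * (exp (K * (r - a)) * dist u v)"
        by (intro mult_mono dist_bounded) auto
      finally show "norm (f r (exp (K * (r - a)) *\<^sub>R u r) - f r (exp (K * (r - a)) *\<^sub>R v r))
         \<le> \<bar>L\<bar> * dist u v * exp (K * (r - a))" by (simp add: mult_ac)
    qed
    also have "\<dots> = \<bar>L\<bar> * dist u v * ((exp (K * (s - a)) - 1) / K)"
      using integral_unique[OF exp_int] by (simp add: diff_divide_distrib)
    also have "\<dots> \<le> K / 2 * dist u v * (exp (K * (s - a)) / K)"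
      using K s by (intro mult_mono divide_right_mono) auto
    also have "\<dots> = 1/2 * dist u v * exp (K * (s - a))" using K by simp
    finally have *: "norm (I u s - I v s) \<le> 1/2 * dist u v * exp (K * (s - a))" .
    have "dist (T u t) (T v t) = exp (- K * (s - a)) * norm (I u s - I v s)"
      by (simp add: T_def s_def dist_norm scaleR_right_diff_distrib[symmetric])
    also have "\<dots> \<le> exp (- K * (s - a)) * (1/2 * dist u v * exp (K * (s - a)))"
      by (intro mult_left_mono *) auto
    also have "\<dots> = 1/2 * dist u v * exp (- K * (s - a) + K * (s - a))"
      by (simp only: exp_add mult_ac)
    also have "\<dots> = 1/2 * dist u v" by simp
    finally show "dist (apply_bcontfun (Bcontfun (T u)) t) (apply_bcontfun (Bcontfun (T v)) t) \<le> 1/2 * dist u v"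
      by (simp add: Bcontfun_inverse T_bc)
  qed
  have "\<exists>!u. Bcontfun (T u) = u"
    by (rule banach_fix_type[of "1/2"]) (use contr in auto)
  then obtain u where "Bcontfun (T u) = u" by blast
  then have u: "T u t = apply_bcontfun u t" for t by (metis Bcontfun_inverse T_bc)
  define z where "z = (\<lambda>t. exp (K * (t - a)) *\<^sub>R apply_bcontfun u t)"
  have z: "z t = z0 + integral {a..t} (\<lambda>s. f s (z s))" if "t \<in> {a..b}" for t
  proof -
    have "z t = exp (K * (t - a)) *\<^sub>R (exp (- K * (t - a)) *\<^sub>R I u t)"
      unfolding z_def u[symmetric] T_def using that by (simp add: c_id)
    also have "\<dots> = I u t" by (simp add: exp_add[symmetric])
    finally show ?thesis by (simp add: I_def z_def)
  qed
  show thesis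
  proof
    show "z a = z0" using z[of a] \<open>a \<le> b\<close> by simp
    fix t assume t: "t \<in> {a..b}"
    have "((\<lambda>t. z0 + integral {a..t} (\<lambda>s. f s (z s))) has_vector_derivative 0 + f t (z t)) (at t within {a..b})"
      by (intro has_vector_derivative_add has_vector_derivative_const integral_has_vector_derivative t)
         (use cf[of u] in \<open>simp add: z_def\<close>)
    then show "(z has_vector_derivative f t (z t)) (at t within {a..b})"
      by (intro has_vector_derivative_transform[OF t z]) simp_all
  qed
qed

section \<open>Interpolation and lower bounds for thrice differentiable functions\<close>

text \<open>
  At an end point of an interval the derivatives are one-sided, and \<open>y3\<close> need not be continuous.
\<close>

definition derivs3_on :: "real set \<Rightarrow> (real \<Rightarrow> real) \<Rightarrow> (real \<Rightarrow> real) \<Rightarrow> (real \<Rightarrow> real) \<Rightarrow> (real \<Rightarrow> real) \<Rightarrow> bool"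
  where "derivs3_on S y y1 y2 y3 \<longleftrightarrow>
    (\<forall>t\<in>S. (y has_real_derivative y1 t) (at t within S) \<and>
           (y1 has_real_derivative y2 t) (at t within S) \<and>
           (y2 has_real_derivative y3 t) (at t within S))"

lemma derivs3_onD:
  assumes "derivs3_on S y y1 y2 y3" "t \<in> S"
  shows "(y has_real_derivative y1 t) (at t within S)"
    "(y1 has_real_derivative y2 t) (at t within S)"
    "(y2 has_real_derivative y3 t) (at t within S)"
  using assms by (auto simp: derivs3_on_def)

lemma derivs3_on_continuous:
  assumes "derivs3_on S y y1 y2 y3"
  shows "continuous_on S y" "continuous_on S y1" "continuous_on S y2"
  using derivs3_onD[OF assms] by (auto intro!: DERIV_continuous_on)

lemma derivs3_on_subset:
  assumes "derivs3_on S y y1 y2 y3" "T \<subseteq> S"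
  shows "derivs3_on T y y1 y2 y3"
  using assms unfolding derivs3_on_def by (meson DERIV_subset subsetD)

lemma derivs3_on_diff:
  assumes "derivs3_on S y y1 y2 y3" "derivs3_on S z z1 z2 z3"
  shows "derivs3_on S (\<lambda>t. y t - z t) (\<lambda>t. y1 t - z1 t) (\<lambda>t. y2 t - z2 t) (\<lambda>t. y3 t - z3 t)"
  using assms unfolding derivs3_on_def by (auto intro!: derivative_intros)

lemma variation_le_integral:
  fixes f :: "real \<Rightarrow> real"
  assumes deriv: "\<And>x. x \<in> {a..b} \<Longrightarrow> (f has_real_derivative f' x) (at x within {a..b})"
    and cont: "continuous_on {a..b} f'"
    and s: "s \<in> {a..b}" and t: "t \<in> {a..b}"
  shows "\<bar>f t - f s\<bar> \<le> integral {a..b} (\<lambda>x. \<bar>f' x\<bar>)"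
proof -
  have *: "\<bar>f t - f s\<bar> \<le> integral {a..b} (\<lambda>x. \<bar>f' x\<bar>)" if "s \<in> {a..b}" "t \<in> {a..b}" "s \<le> t" for s t
  proof -
    have sub: "{s..t} \<subseteq> {a..b}" using that by auto
    have c: "continuous_on {s..t} f'" by (rule continuous_on_subset[OF cont sub])
    have "(f' has_integral f t - f s) {s..t}"
      by (rule fundamental_theorem_of_calculus[OF \<open>s \<le> t\<close>])
         (use DERIV_subset[OF deriv sub] sub in \<open>auto simp: has_real_derivative_iff_has_vector_derivative\<close>)
    then have "\<bar>f t - f s\<bar> = norm (integral {s..t} f')" by (simp add: integral_unique)
    also have "\<dots> \<le> integral {s..t} (\<lambda>x. \<bar>f' x\<bar>)"
      by (rule integral_norm_bound_integral) (auto intro!: integrable_continuous_real continuous_intros c)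
    also have "\<dots> \<le> integral {a..b} (\<lambda>x. \<bar>f' x\<bar>)"
      by (rule integral_subset_le[OF sub]) (auto intro!: integrable_continuous_real continuous_intros c cont)
    finally show ?thesis .
  qed
  show ?thesis
  proof (cases "s \<le> t")
    case False
    then show ?thesis using *[OF t s] by (simp add: abs_minus_commute)
  qed (use *[OF s t] in simp)
qed

lemma small_value_in_subinterval:
  fixes f :: "real \<Rightarrow> real"
  assumes cont: "continuous_on {a..b} f" and sub: "{u..v} \<subseteq> {a..b}" and "u \<le> v"
  obtains x where "x \<in> {u..v}" "\<bar>f x\<bar> * (v - u) \<le> integral {a..b} (\<lambda>x. \<bar>f x\<bar>)"
proof -
  have c: "continuous_on {u..v} f" by (rule continuous_on_subset[OF cont sub])
  obtain x where x: "x \<in> {u..v}" "\<And>y. y \<in> {u..v} \<Longrightarrow> \<bar>f x\<bar> \<le> \<bar>f y\<bar>"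
    using continuous_attains_inf[of "{u..v}" "\<lambda>x. \<bar>f x\<bar>"] continuous_on_rabs[OF c] \<open>u \<le> v\<close>
    by (metis atLeastAtMost_iff atLeastatMost_empty_iff compact_Icc order.refl)
  have "\<bar>f x\<bar> * (v - u) = integral {u..v} (\<lambda>_. \<bar>f x\<bar>)" using \<open>u \<le> v\<close> by simp
  also have "\<dots> \<le> integral {u..v} (\<lambda>x. \<bar>f x\<bar>)"
    by (rule integral_le) (auto intro!: integrable_continuous_real continuous_intros c x)
  also have "\<dots> \<le> integral {a..b} (\<lambda>x. \<bar>f x\<bar>)"
    by (rule integral_subset_le[OF sub]) (auto intro!: integrable_continuous_real continuous_intros c cont)
  finally show thesis using that x(1) by blast
qed

lemma small_slope_between:
  fixes f :: "real \<Rightarrow> real"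
  assumes deriv: "\<And>x. x \<in> {a..b} \<Longrightarrow> (f has_real_derivative f' x) (at x within {a..b})"
    and x: "x \<in> {a..b}" "\<bar>f x\<bar> \<le> M" and y: "y \<in> {a..b}" "\<bar>f y\<bar> \<le> M"
    and d: "d > 0" "x + d \<le> y"
  obtains z where "z \<in> {x<..<y}" "\<bar>f' z\<bar> \<le> 2 * M / d"
proof -
  have "x < y" using d by simp
  have "\<exists>z\<in>{x<..<y}. f y - f x = f' z * (y - x)"
  proof (rule mvt_simple[OF \<open>x < y\<close>, of f "\<lambda>z h. f' z * h"])
    fix z assume "x \<le> z" "z \<le> y"
    then have "(f has_real_derivative f' z) (at z within {x..y})"
      using x y by (intro DERIV_subset[OF deriv]) auto
    then show "(f has_derivative (\<lambda>h. f' z * h)) (at z within {x..y})"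
      by (simp add: has_field_derivative_def)
  qed
  then obtain z where z: "z \<in> {x<..<y}" "f y - f x = f' z * (y - x)" by blast
  have "\<bar>f' z\<bar> * d \<le> \<bar>f' z\<bar> * (y - x)" using d by (intro mult_left_mono) auto
  also have "\<dots> = \<bar>f y - f x\<bar>" using z \<open>x < y\<close> by (simp add: abs_mult)
  also have "\<dots> \<le> 2 * M" using x y by linarith
  finally have "\<bar>f' z\<bar> \<le> 2 * M / d" using d by (simp add: field_simps)
  with z(1) that show thesis by blast
qed

text \<open>
  Interpolation: a function that is small on average and has a small third derivative on
  average is small together with its first two derivatives. Among seven equal subintervals the first,
  third, fifth and seventh each contain a point where \<open>w\<close> is at most \<open>7 * K\<close>; the mean value theorem
  on the two outer pairs gives two points of small slope which are still \<open>l / 7\<close> apart, hence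
  a point where \<open>w2\<close> is small, and integrating back recovers \<open>w2\<close>, \<open>w1\<close> and \<open>w\<close>. The bounds are linear
  in \<open>K\<close> and carry the scaling in \<open>l\<close>, so the same lemma serves for boundedness
  (\<open>l = 1\<close>) and for the asymptotics (\<open>l\<close> small, \<open>K\<close> small).
\<close>

lemma derivatives_bounded_by_integrals:
  assumes w: "derivs3_on {c..c + l} w w1 w2 w3" and "l > 0"
    and cont: "continuous_on {c..c + l} w3"
    and K0: "integral {c..c + l} (\<lambda>t. \<bar>w t\<bar>) \<le> K * l"
    and K3: "integral {c..c + l} (\<lambda>t. \<bar>w3 t\<bar>) \<le> K / l\<^sup>2"
    and t: "t \<in> {c..c + l}"
  shows "\<bar>w t\<bar> \<le> 1478 * K" "\<bar>w1 t\<bar> \<le> 1471 * K / l" "\<bar>w2 t\<bar> \<le> 1373 * K / l\<^sup>2"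
proof -
  note d = derivs3_onD[OF w] and wc = derivs3_on_continuous[OF w]
  have "\<exists>x\<in>{c + k * l / 7..c + (k + 1) * l / 7}. \<bar>w x\<bar> \<le> 7 * K" if "k \<in> {0..6}" for k
  proof -
    have "{c + k * l / 7..c + (k + 1) * l / 7} \<subseteq> {c..c + l}"
    proof -
      have "k * l \<ge> 0" "(k + 1) * l \<le> 7 * l" using that \<open>l > 0\<close> by (auto intro: mult_right_mono)
      then show ?thesis by auto
    qed
    moreover have "c + k * l / 7 \<le> c + (k + 1) * l / 7" using \<open>l > 0\<close> by (simp add: field_simps)
    ultimately obtain x where x: "x \<in> {c + k * l / 7..c + (k + 1) * l / 7}"
      "\<bar>w x\<bar> * (c + (k + 1) * l / 7 - (c + k * l / 7)) \<le> integral {c..c + l} (\<lambda>x. \<bar>w x\<bar>)"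
      by (rule small_value_in_subinterval[OF wc(1)])
    have "\<bar>w x\<bar> * (l / 7) \<le> K * l" using x(2) K0 by (simp add: field_simps)
    then have "\<bar>w x\<bar> \<le> 7 * K" using \<open>l > 0\<close> by (simp add: field_simps)
    then show ?thesis using x(1) by blast
  qed
  note pt = this
  obtain x0 where x0: "x0 \<in> {c..c + l / 7}" "\<bar>w x0\<bar> \<le> 7 * K" using pt[of 0] by auto
  obtain x2 where x2: "x2 \<in> {c + 2 * l / 7..c + 3 * l / 7}" "\<bar>w x2\<bar> \<le> 7 * K" using pt[of 2] by auto
  obtain x4 where x4: "x4 \<in> {c + 4 * l / 7..c + 5 * l / 7}" "\<bar>w x4\<bar> \<le> 7 * K" using pt[of 4] by auto
  obtain x6 where x6: "x6 \<in> {c + 6 * l / 7..c + l}" "\<bar>w x6\<bar> \<le> 7 * K" using pt[of 6] by auto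
  have "l / 7 > 0" using \<open>l > 0\<close> by simp
  obtain y1 where y1: "y1 \<in> {x0<..<x2}" "\<bar>w1 y1\<bar> \<le> 2 * (7 * K) / (l / 7)"
    using small_slope_between[OF d(1) _ x0(2) _ x2(2) \<open>l / 7 > 0\<close>] x0(1) x2(1) \<open>l > 0\<close> by auto
  obtain y2 where y2: "y2 \<in> {x4<..<x6}" "\<bar>w1 y2\<bar> \<le> 2 * (7 * K) / (l / 7)"
    using small_slope_between[OF d(1) _ x4(2) _ x6(2) \<open>l / 7 > 0\<close>] x4(1) x6(1) \<open>l > 0\<close> by auto
  have y1m: "y1 \<in> {c..c + l}" and y2m: "y2 \<in> {c..c + l}"
    using y1(1) y2(1) x0(1) x2(1) x4(1) x6(1) \<open>l > 0\<close> by auto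
  obtain z where z: "z \<in> {y1<..<y2}" "\<bar>w2 z\<bar> \<le> 2 * (2 * (7 * K) / (l / 7)) / (l / 7)"
    using small_slope_between[OF d(2) y1m y1(2) y2m y2(2) \<open>l / 7 > 0\<close>] y1(1) y2(1) x2(1) x4(1) by auto
  have zm: "z \<in> {c..c + l}" using z(1) y1m y2m by auto
  have b2: "\<bar>w2 s\<bar> \<le> 1373 * K / l\<^sup>2" if s: "s \<in> {c..c + l}" for s
  proof -
    have "\<bar>w2 s - w2 z\<bar> \<le> integral {c..c + l} (\<lambda>t. \<bar>w3 t\<bar>)"
      by (rule variation_le_integral[OF d(3) cont zm s])
    then have "\<bar>w2 s\<bar> \<le> 2 * (2 * (7 * K) / (l / 7)) / (l / 7) + K / l\<^sup>2"
      using z(2) K3 by linarith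
    also have "\<dots> = 1373 * K / l\<^sup>2" using \<open>l > 0\<close> by (simp add: field_simps power2_eq_square)
    finally show ?thesis .
  qed
  have b1: "\<bar>w1 s\<bar> \<le> 1471 * K / l" if s: "s \<in> {c..c + l}" for s
  proof -
    have "integral {c..c + l} (\<lambda>t. \<bar>w2 t\<bar>) \<le> integral {c..c + l} (\<lambda>t. 1373 * K / l\<^sup>2)"
      by (rule integral_le) (auto intro!: integrable_continuous_real continuous_intros wc b2)
    also have "\<dots> = 1373 * K / l" using \<open>l > 0\<close> by (simp add: field_simps power2_eq_square)
    finally have "integral {c..c + l} (\<lambda>t. \<bar>w2 t\<bar>) \<le> 1373 * K / l" .
    moreover have "\<bar>w1 s - w1 y1\<bar> \<le> integral {c..c + l} (\<lambda>t. \<bar>w2 t\<bar>)"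
      by (rule variation_le_integral[OF d(2) wc(3) y1m s])
    ultimately have "\<bar>w1 s - w1 y1\<bar> \<le> 1373 * K / l" by (rule order.trans[rotated])
    with y1(2) have "\<bar>w1 y1\<bar> + \<bar>w1 s - w1 y1\<bar> \<le> 2 * (7 * K) / (l / 7) + 1373 * K / l"
      by (rule add_mono)
    moreover have "\<bar>w1 s\<bar> \<le> \<bar>w1 y1\<bar> + \<bar>w1 s - w1 y1\<bar>" by linarith
    ultimately have "\<bar>w1 s\<bar> \<le> 2 * (7 * K) / (l / 7) + 1373 * K / l" by (rule order.trans[rotated])
    also have "\<dots> = 1471 * K / l" using \<open>l > 0\<close> by (simp add: field_simps power2_eq_square)
    finally show ?thesis .
  qed
  have "integral {c..c + l} (\<lambda>t. \<bar>w1 t\<bar>) \<le> integral {c..c + l} (\<lambda>t. 1471 * K / l)"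
    by (rule integral_le) (auto intro!: integrable_continuous_real continuous_intros wc b1)
  also have "\<dots> = 1471 * K" using \<open>l > 0\<close> by (simp add: field_simps power2_eq_square)
  finally have i1: "integral {c..c + l} (\<lambda>t. \<bar>w1 t\<bar>) \<le> 1471 * K" .
  have "x0 \<in> {c..c + l}" using x0(1) \<open>l > 0\<close> by auto
  have "\<bar>w t - w x0\<bar> \<le> integral {c..c + l} (\<lambda>t. \<bar>w1 t\<bar>)"
    by (rule variation_le_integral[OF d(1) wc(2) \<open>x0 \<in> {c..c + l}\<close> t])
  then show "\<bar>w t\<bar> \<le> 1478 * K" using x0(2) i1 by linarith
  show "\<bar>w1 t\<bar> \<le> 1471 * K / l" "\<bar>w2 t\<bar> \<le> 1373 * K / l\<^sup>2" using b1 b2 t by auto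
qed

text \<open>
  A function with slope at most \<open>M\<close> that falls below \<open>\<epsilon>\<close> stays below \<open>2 * \<epsilon>\<close> on an
  interval of length \<open>\<epsilon> / M\<close>, where \<open>b\<close>, which behaves like \<open>1 / y ^ 3\<close>, contributes at least
  \<open>1 / (8 * M * \<epsilon>\<^sup>2)\<close> to the integral. This exceeds \<open>K\<close> when \<open>\<epsilon>\<close> is small.
\<close>

lemma lower_bound_from_integral:
  assumes deriv: "\<And>x. x \<in> {c..c + 1} \<Longrightarrow> (y has_real_derivative y1 x) (at x within {c..c + 1})"
    and slope: "\<And>x. x \<in> {c..c + 1} \<Longrightarrow> \<bar>y1 x\<bar> \<le> M"
    and b: "continuous_on {c..c + 1} b" "\<And>x. x \<in> {c..c + 1} \<Longrightarrow> 0 \<le> b x"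
    and sing: "\<And>x. x \<in> {c..c + 1} \<Longrightarrow> y x \<le> 2 * \<epsilon> \<Longrightarrow> 1 / (2 * \<epsilon>) ^ 3 \<le> b x"
    and int: "integral {c..c + 1} b \<le> K"
    and eps: "0 < \<epsilon>" "2 * \<epsilon> \<le> M" "8 * M * K * \<epsilon>\<^sup>2 < 1"
    and t: "t \<in> {c..c + 1}"
  shows "\<epsilon> \<le> y t"
proof (rule ccontr)
  assume "\<not> \<epsilon> \<le> y t"
  then have "y t < \<epsilon>" by simp
  have "M > 0" using eps by linarith
  \<comment> \<open>Half of the unit interval lies on one side of \<open>t\<close>, and \<open>r \<le> 1/2\<close>.\<close>
  define r where "r = \<epsilon> / M"
  have r: "0 < r" "r \<le> 1/2" using eps \<open>M > 0\<close> by (auto simp: r_def field_simps)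
  define u where "u = (if t \<le> c + 1/2 then t else t - r)"
  have u: "{u..u + r} \<subseteq> {c..c + 1}" "\<And>x. x \<in> {u..u + r} \<Longrightarrow> \<bar>x - t\<bar> \<le> r"
    using t r by (auto simp: u_def split: if_splits)
  have cy1: "y x \<le> 2 * \<epsilon>" if x: "x \<in> {u..u + r}" for x
  proof -
    have xm: "x \<in> {c..c + 1}" using u(1) x by auto
    have "norm (y x - y t) \<le> M * norm (x - t)"
    proof (rule differentiable_bound[of "{c..c+1}" y "\<lambda>x h. y1 x * h"])
      fix s assume s: "s \<in> {c..c + 1}"
      show "(y has_derivative (*) (y1 s)) (at s within {c..c + 1})"
        using deriv[OF s] by (simp add: has_field_derivative_def)
      show "onorm ((*) (y1 s)) \<le> M"
        by (rule onorm_bound) (use slope[OF s] \<open>M > 0\<close> in \<open>auto simp: abs_mult intro: mult_right_mono\<close>)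
    qed (use xm t in auto)
    also have "\<dots> \<le> M * r" using u(2)[OF x] \<open>M > 0\<close> by auto
    also have "\<dots> = \<epsilon>" using \<open>M > 0\<close> by (simp add: r_def)
    finally show ?thesis using \<open>y t < \<epsilon>\<close> by auto
  qed
  have cb: "continuous_on {u..u + r} b" by (rule continuous_on_subset[OF b(1) u(1)])
  have "r * (1 / (2 * \<epsilon>) ^ 3) = integral {u..u + r} (\<lambda>_. 1 / (2 * \<epsilon>) ^ 3)" using r by simp
  also have "\<dots> \<le> integral {u..u + r} b"
    by (rule integral_le) (use cy1 sing u(1) in \<open>auto intro!: integrable_continuous_real continuous_intros cb\<close>)
  also have "\<dots> \<le> integral {c..c + 1} b"
    by (rule integral_subset_le[OF u(1)]) (use b in \<open>auto intro!: integrable_continuous_real continuous_intros cb\<close>)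
  finally have "r * (1 / (2 * \<epsilon>) ^ 3) \<le> K" using int by simp
  moreover have "r * (1 / (2 * \<epsilon>) ^ 3) = 1 / (8 * M * \<epsilon>\<^sup>2)"
    using eps \<open>M > 0\<close> by (simp add: r_def field_simps power3_eq_cube power2_eq_square)
  moreover have "8 * M * \<epsilon>\<^sup>2 > 0" using eps \<open>M > 0\<close> by simp
  ultimately have "1 \<le> K * (8 * M * \<epsilon>\<^sup>2)" by (simp add: pos_divide_le_eq)
  with eps show False by (simp add: mult_ac)
qed

section \<open>A two-point boundary value problem of third order\<close>

lemma abs_le_norm_triple:
  fixes p q r :: real
  shows "\<bar>p\<bar> \<le> norm (p, q, r)" "\<bar>q\<bar> \<le> norm (p, q, r)" "\<bar>r\<bar> \<le> norm (p, q, r)"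
  using norm_fst_le[of p "(q, r)"] norm_snd_le[of "(q, r)" p] norm_fst_le[of q r] norm_snd_le[of r q]
  by auto

lemma norm_triple_le:
  fixes p q r :: real
  shows "norm (p, q, r) \<le> \<bar>p\<bar> + \<bar>q\<bar> + \<bar>r\<bar>"
  using norm_Pair_le[of p "(q, r)"] norm_Pair_le[of q r] by simp

text \<open>
  The difference of two solutions of a third-order equation is treated as a first-order system
  for the jet \<open>(p, q, r)\<close>, whose derivative is \<open>(q, r, s)\<close>; this is its Lipschitz bound.
\<close>

lemma norm_jet_derivative_le:
  fixes p q r s :: real
  assumes "\<bar>s\<bar> \<le> L * \<bar>p\<bar>" "0 \<le> L"
  shows "norm (q, r, s) \<le> (2 + L) * norm (p, q, r)"
proof -
  have "norm (q, r, s) \<le> \<bar>q\<bar> + \<bar>r\<bar> + \<bar>s\<bar>" by (rule norm_triple_le)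
  also have "\<dots> \<le> norm (p, q, r) + norm (p, q, r) + L * norm (p, q, r)"
    using assms mult_left_mono[OF abs_le_norm_triple(1)[of p q r] assms(2)]
      abs_le_norm_triple(2)[of q p r] abs_le_norm_triple(3)[of r p q]
    by (intro add_mono) auto
  finally show ?thesis by (simp add: algebra_simps)
qed

lemma derivs3_on_iff_jet:
  "derivs3_on S y y1 y2 y3 \<longleftrightarrow>
    (\<forall>t\<in>S. ((\<lambda>t. (y t, y1 t, y2 t)) has_vector_derivative (y1 t, y2 t, y3 t)) (at t within S))"
proof (intro iffI ballI)
  fix t assume "derivs3_on S y y1 y2 y3" "t \<in> S"
  then show "((\<lambda>t. (y t, y1 t, y2 t)) has_vector_derivative (y1 t, y2 t, y3 t)) (at t within S)"
    unfolding derivs3_on_def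
    by (auto intro!: has_vector_derivative_Pair simp: has_real_derivative_iff_has_vector_derivative[symmetric])
next
  assume *: "\<forall>t\<in>S. ((\<lambda>t. (y t, y1 t, y2 t)) has_vector_derivative (y1 t, y2 t, y3 t)) (at t within S)"
  show "derivs3_on S y y1 y2 y3"
    unfolding derivs3_on_def
  proof (intro ballI)
    fix t assume "t \<in> S"
    with * have d: "((\<lambda>t. (y t, y1 t, y2 t)) has_derivative (\<lambda>h. h *\<^sub>R (y1 t, y2 t, y3 t))) (at t within S)"
      by (simp add: has_vector_derivative_def)
    note d1 = has_derivative_fst[OF d, simplified] and d2 = has_derivative_snd[OF d, simplified]
    note d21 = has_derivative_fst[OF d2, simplified] and d22 = has_derivative_snd[OF d2, simplified]
    show "(y has_real_derivative y1 t) (at t within S) \<and> (y1 has_real_derivative y2 t) (at t within S) \<and>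
        (y2 has_real_derivative y3 t) (at t within S)"
      unfolding has_field_derivative_def
      by (intro conjI has_derivative_eq_rhs[OF d1] has_derivative_eq_rhs[OF d21] has_derivative_eq_rhs[OF d22])
         (auto simp: fun_eq_iff)
  qed
qed

lemma third_order_ivp:
  fixes F :: "real \<Rightarrow> real \<Rightarrow> real"
  assumes "a \<le> b"
    and cont: "continuous_on ({a..b} \<times> UNIV) (\<lambda>(t, x). F t x)"
    and lip: "\<And>t x y. t \<in> {a..b} \<Longrightarrow> \<bar>F t x - F t y\<bar> \<le> L * \<bar>x - y\<bar>"
  obtains y y1 y2 where "y a = y\<^sub>0" "y1 a = p\<^sub>0" "y2 a = r\<^sub>0"
    "derivs3_on {a..b} y y1 y2 (\<lambda>t. F t (y t))"
proof -
  define f where "f = (\<lambda>t (v :: real \<times> real \<times> real). (fst (snd v), snd (snd v), F t (fst v)))"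
  have cf: "continuous_on ({a..b} \<times> UNIV) (\<lambda>(t, v). f t v)"
  proof -
    have "continuous_on ({a..b} \<times> UNIV) (\<lambda>p. (\<lambda>(t, x). F t x) (fst p, fst (snd p)))"
      by (rule continuous_on_compose2[OF cont]) (auto intro!: continuous_intros)
    then show ?thesis
      unfolding f_def by (auto intro!: continuous_intros simp: case_prod_beta)
  qed
  have L: "0 \<le> L" using lip[of a 1 0] \<open>a \<le> b\<close> by auto
  have lf: "norm (f t v - f t w) \<le> (2 + L) * norm (v - w)" if t: "t \<in> {a..b}" for t v w
    using norm_jet_derivative_le[OF lip[OF t, of "fst v" "fst w"] L]
    by (cases v; cases w) (simp add: f_def)
  obtain z where z: "z a = (y\<^sub>0, p\<^sub>0, r\<^sub>0)"
    "\<And>t. t \<in> {a..b} \<Longrightarrow> (z has_vector_derivative f t (z t)) (at t within {a..b})"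
    using picard_lindelof[OF \<open>a \<le> b\<close> cf lf] by blast
  show thesis
  proof
    show "fst (z a) = y\<^sub>0" "fst (snd (z a)) = p\<^sub>0" "snd (snd (z a)) = r\<^sub>0" by (auto simp: z)
    show "derivs3_on {a..b} (\<lambda>t. fst (z t)) (\<lambda>t. fst (snd (z t))) (\<lambda>t. snd (snd (z t))) (\<lambda>t. F t (fst (z t)))"
      unfolding derivs3_on_iff_jet using z(2) by (simp add: f_def)
  qed
qed

lemma third_order_gronwall:
  assumes y: "derivs3_on {a..b} y y1 y2 y3" and z: "derivs3_on {a..b} z z1 z2 z3"
    and lip: "\<And>t. t \<in> {a..b} \<Longrightarrow> \<bar>y3 t - z3 t\<bar> \<le> L * \<bar>y t - z t\<bar>" and "0 \<le> L"
    and s: "s \<in> {a..b}" and t: "t \<in> {a..b}"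
  shows "norm (y t - z t, y1 t - z1 t, y2 t - z2 t)
    \<le> exp ((2 + L) * \<bar>t - s\<bar>) * norm (y s - z s, y1 s - z1 s, y2 s - z2 s)"
  by (rule gronwall_norm[OF derivs3_on_diff[OF y z, unfolded derivs3_on_iff_jet, rule_format]
        norm_jet_derivative_le[OF lip \<open>0 \<le> L\<close>] s t])

text \<open>
  Since \<open>d3\<close> is nonnegative as long as \<open>d\<close> is, the inequality \<open>d2 > \<sigma> / 2\<close> propagates: up to the
  first time it could fail, \<open>d1\<close> and \<open>d\<close> are nonnegative, so \<open>d2\<close> has not decreased from its
  initial value \<open>\<sigma>\<close>.
\<close>

lemma third_order_comparison:
  assumes d: "derivs3_on {a..b} d d1 d2 d3" and "a < b"
    and init: "d a = 0" "d1 a = 0" "d2 a = \<sigma>" "\<sigma> > 0"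
    and mono: "\<And>t. t \<in> {a..b} \<Longrightarrow> 0 \<le> d t \<Longrightarrow> 0 \<le> d3 t"
  shows "\<sigma> / 4 * (b - a)\<^sup>2 \<le> d b"
proof -
  note D = derivs3_onD[OF d] and C = derivs3_on_continuous[OF d]
  have low: "\<sigma> / 2 * (t - a) \<le> d1 t \<and> \<sigma> / 4 * (t - a)\<^sup>2 \<le> d t"
    if t: "t \<in> {a..b}" and d2: "\<And>x. x \<in> {a..t} \<Longrightarrow> \<sigma> / 2 \<le> d2 x" for t
  proof -
    have am: "a \<in> {a..b}" using \<open>a < b\<close> by simp
    have l1: "\<sigma> / 2 * (s - a) \<le> d1 s" if s: "s \<in> {a..t}" for s
    proof -
      have sm: "s \<in> {a..b}" "a \<le> s" using s t by auto
      have "d1 a - \<sigma> / 2 * (a - a) \<le> d1 s - \<sigma> / 2 * (s - a)"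
      proof (rule nondecreasing_on_interval[OF _ _ am sm])
        fix x assume "x \<in> {a..b}"
        then show "((\<lambda>x. d1 x - \<sigma> / 2 * (x - a)) has_real_derivative d2 x - \<sigma> / 2) (at x within {a..b})"
          by (auto intro!: derivative_eq_intros D)
      qed (use d2 s in auto)
      then show ?thesis using init by simp
    qed
    have "d a - \<sigma> / 4 * (a - a)\<^sup>2 \<le> d t - \<sigma> / 4 * (t - a)\<^sup>2"
    proof (rule nondecreasing_on_interval[OF _ _ am t])
      fix x assume "x \<in> {a..b}"
      then show "((\<lambda>x. d x - \<sigma> / 4 * (x - a)\<^sup>2) has_real_derivative d1 x - \<sigma> / 2 * (x - a)) (at x within {a..b})"
        by (auto intro!: derivative_eq_intros D)
    qed (use l1 t in auto)
    then show ?thesis using init l1[of t] t by simp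
  qed
  have d2: "\<sigma> / 2 < d2 t" if "t \<in> {a..b}" for t
  proof (rule ccontr)
    \<comment> \<open>The first time at which the claim fails is the least element of a compact set.\<close>
    define S where "S = {t \<in> {a..b}. d2 t \<le> \<sigma> / 2}"
    assume "\<not> \<sigma> / 2 < d2 t"
    with that have "S \<noteq> {}" by (auto simp: S_def)
    have "compact S"
    proof -
      have "S = {a..b} \<inter> d2 -` {..\<sigma> / 2} \<inter> {a..b}" by (auto simp: S_def)
      moreover have "closed ({a..b} \<inter> d2 -` {..\<sigma> / 2})"
        by (rule continuous_closed_preimage[OF C(3)]) auto
      ultimately show ?thesis using closed_Int_compact compact_Icc by metis
    qed
    then obtain m where m: "m \<in> S" "\<And>x. x \<in> S \<Longrightarrow> m \<le> x"
      using compact_attains_inf[OF _ \<open>S \<noteq> {}\<close>] by blast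
    have mm: "m \<in> {a..b}" "d2 m \<le> \<sigma> / 2" using m(1) by (auto simp: S_def)
    have "m \<noteq> a" using mm init by auto
    have before: "\<sigma> / 2 \<le> d2 x" if "x \<in> {a..<m}" for x
      using m(2)[of x] that mm by (force simp: S_def)
    have pos: "0 \<le> d x" if x: "x \<in> {a..<m}" for x
    proof -
      have "\<sigma> / 4 * (x - a)\<^sup>2 \<le> d x" using low[of x] before x mm by auto
      moreover have "0 \<le> \<sigma> / 4 * (x - a)\<^sup>2" using init by auto
      ultimately show ?thesis by linarith
    qed
    have "d m \<ge> 0"
    proof (rule tendsto_lowerbound)
      have "(d \<longlongrightarrow> d m) (at m within {a..b})" using C(1) mm by (auto simp: continuous_on_def)
      then show "(d \<longlongrightarrow> d m) (at m within {a..m})" by (rule tendsto_within_subset) (use mm in auto)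
      show "\<forall>\<^sub>F x in at m within {a..m}. 0 \<le> d x"
        using pos by (auto simp: eventually_at_filter intro!: always_eventually)
      have "a < m" using \<open>m \<noteq> a\<close> mm by auto
      then show "at m within {a..m} \<noteq> bot"
        by (simp add: at_within_Icc_at_left trivial_limit_at_left_real)
    qed
    with pos have "0 \<le> d3 x" if "x \<in> {a..m}" for x
      using that mm by (intro mono) (cases "x = m"; auto)+
    then have "d2 a \<le> d2 m"
      using mm \<open>a < b\<close> D(3) by (intro nondecreasing_on_interval[of a b d2 d3 a m]) auto
    with mm init show False by simp
  qed
  then show ?thesis using low[of b] \<open>a < b\<close> by (simp add: less_imp_le)
qed

text \<open>
  Shooting in the single free parameter \<open>s\<close>, the second derivative at the left end. By
  \<open>third_order_comparison\<close> the value at \<open>b\<close> grows at least linearly in \<open>s\<close>, by Gronwall's inequality it is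
  continuous in \<open>s\<close>, so it takes every value. The lopsided choice of two conditions at the left
  end and one at the right end is what makes the third derivative dissipative in
  \<open>skew_energy_identity\<close>.
\<close>

lemma third_order_bvp:
  fixes F :: "real \<Rightarrow> real \<Rightarrow> real"
  assumes "a < b"
    and cont: "continuous_on ({a..b} \<times> UNIV) (\<lambda>(t, x). F t x)"
    and lip: "\<And>t x y. t \<in> {a..b} \<Longrightarrow> \<bar>F t x - F t y\<bar> \<le> L * \<bar>x - y\<bar>"
    and mono: "\<And>t x y. t \<in> {a..b} \<Longrightarrow> x \<le> y \<Longrightarrow> F t x \<le> F t y"
  obtains y y1 y2 where "y a = y\<^sub>a" "y1 a = p\<^sub>a" "y b = y\<^sub>b"
    "derivs3_on {a..b} y y1 y2 (\<lambda>t. F t (y t))"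
proof -
  have "\<forall>s. \<exists>y y1 y2. y a = y\<^sub>a \<and> y1 a = p\<^sub>a \<and> y2 a = s \<and> derivs3_on {a..b} y y1 y2 (\<lambda>t. F t (y t))"
    using third_order_ivp[OF _ cont lip] \<open>a < b\<close> by (metis less_imp_le)
  then obtain Y Y1 Y2 where Y: "\<And>s. Y s a = y\<^sub>a" "\<And>s. Y1 s a = p\<^sub>a" "\<And>s. Y2 s a = s"
    "\<And>s. derivs3_on {a..b} (Y s) (Y1 s) (Y2 s) (\<lambda>t. F t (Y s t))" by metis
  have L: "0 \<le> L" using lip[of a 1 0] \<open>a < b\<close> by auto
  have grow: "(s - s') / 4 * (b - a)\<^sup>2 \<le> Y s b - Y s' b" if "s' < s" for s s'
    by (rule third_order_comparison[OF derivs3_on_diff[OF Y(4)[of s] Y(4)[of s']] \<open>a < b\<close>])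
       (use that Y mono in auto)
  define C where "C = exp ((2 + L) * (b - a))"
  have lipY: "\<bar>Y s b - Y s' b\<bar> \<le> C * \<bar>s - s'\<bar>" for s s'
  proof -
    have "\<bar>Y s b - Y s' b\<bar> \<le> norm (Y s b - Y s' b, Y1 s b - Y1 s' b, Y2 s b - Y2 s' b)"
      by (rule abs_le_norm_triple(1))
    also have "\<dots> \<le> exp ((2 + L) * \<bar>b - a\<bar>) * norm (Y s a - Y s' a, Y1 s a - Y1 s' a, Y2 s a - Y2 s' a)"
      by (rule third_order_gronwall[OF Y(4) Y(4) lip L]) (use \<open>a < b\<close> in auto)
    finally show ?thesis using \<open>a < b\<close> by (simp add: Y C_def norm_Pair)
  qed
  have cY: "continuous_on UNIV (\<lambda>s. Y s b)"
    by (rule continuous_on_subset[OF lipschitz_on_continuous_on[of C]])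
       (use lipY in \<open>auto simp: lipschitz_on_def C_def dist_real_def\<close>)
  define q where "q = (b - a)\<^sup>2 / 4"
  have q: "q > 0" using \<open>a < b\<close> by (simp add: q_def)
  define S where "S = (\<bar>y\<^sub>b - Y 0 b\<bar> + 1) / q"
  have S: "S > 0" "S * q = \<bar>y\<^sub>b - Y 0 b\<bar> + 1" using q by (auto simp: S_def)
  have "S * q \<le> Y S b - Y 0 b" "S * q \<le> Y 0 b - Y (-S) b"
    using grow[of 0 S] grow[of "-S" 0] S by (auto simp: q_def)
  then have "Y (-S) b \<le> y\<^sub>b" "y\<^sub>b \<le> Y S b" using S by linarith+
  then obtain s where "Y s b = y\<^sub>b"
    using IVT'[of "\<lambda>s. Y s b" "-S" y\<^sub>b S] S continuous_on_subset[OF cY] by auto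
  with Y that show thesis by blast
qed

text \<open>
  The third derivative is skew-symmetric, so only a boundary term remains, and the three boundary
  conditions leave it with a favourable sign.
\<close>

lemma skew_energy_identity:
  assumes w: "derivs3_on {a..b} w w1 w2 w3" and "a \<le> b"
    and bc: "w a = 0" "w1 a = 0" "w b = 0"
  shows "((\<lambda>t. w3 t * w t) has_integral - (w1 b)\<^sup>2 / 2) {a..b}"
proof -
  note D = derivs3_onD[OF w]
  have "((\<lambda>t. w3 t * w t) has_integral ((w2 b * w b - w1 b * w1 b / 2) - (w2 a * w a - w1 a * w1 a / 2))) {a..b}"
  proof (rule fundamental_theorem_of_calculus[OF \<open>a \<le> b\<close>])
    fix t assume t: "t \<in> {a..b}"
    have "((\<lambda>t. w2 t * w t - w1 t * w1 t / 2) has_real_derivative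
        (w3 t * w t + w1 t * w2 t) - (w2 t * w1 t + w2 t * w1 t) / 2) (at t within {a..b})"
      by (intro DERIV_diff DERIV_mult DERIV_cdivide D[OF t])
    then have "((\<lambda>t. w2 t * w t - w1 t * w1 t / 2) has_real_derivative w3 t * w t) (at t within {a..b})"
      by simp
    then show "((\<lambda>t. w2 t * w t - w1 t * w1 t / 2) has_vector_derivative w3 t * w t) (at t within {a..b})"
      by (simp add: has_real_derivative_iff_has_vector_derivative)
  qed
  then show ?thesis using bc by (simp add: power2_eq_square)
qed

section \<open>The comparison profile\<close>

lemma root_profile_derivs:
  "derivs3_on UNIV (\<lambda>t. (1 + t\<^sup>2) powr (-1/3)) (\<lambda>t. - (2/3) * (t * (1 + t\<^sup>2) powr (-4/3)))
     (\<lambda>t. - (2/3) * (1 + t\<^sup>2) powr (-4/3) + 16/9 * (t\<^sup>2 * (1 + t\<^sup>2) powr (-7/3)))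
     (\<lambda>t. 16/3 * (t * (1 + t\<^sup>2) powr (-7/3)) - 224/27 * (t ^ 3 * (1 + t\<^sup>2) powr (-10/3)))"
proof -
  have p: "0 < 1 + t\<^sup>2" for t :: real by (rule add_pos_nonneg) auto
  have d: "((\<lambda>t. (1 + t\<^sup>2) powr r) has_real_derivative 2 * r * (t * (1 + t\<^sup>2) powr (r - 1))) (at t)" for r t :: real
  proof -
    have "((\<lambda>t. (1 + t\<^sup>2) powr r) has_real_derivative (r * (1 + t\<^sup>2) powr (r - of_nat 1)) * (2 * t)) (at t)"
      by (rule DERIV_fun_powr[of "\<lambda>t. 1 + t\<^sup>2" "2 * t" t r]) (auto intro!: derivative_eq_intros p)
    then show ?thesis by (simp add: mult_ac)
  qed
  have e1: "((\<lambda>t. (1 + t\<^sup>2) powr (-1/3)) has_real_derivative - (2/3) * (t * (1 + t\<^sup>2) powr (-4/3))) (at t)" for t :: real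
    using d[of "-1/3" t] by simp
  have e2: "((\<lambda>t. (1 + t\<^sup>2) powr (-4/3)) has_real_derivative - (8/3) * (t * (1 + t\<^sup>2) powr (-7/3))) (at t)" for t :: real
    using d[of "-4/3" t] by simp
  have e3: "((\<lambda>t. (1 + t\<^sup>2) powr (-7/3)) has_real_derivative - (14/3) * (t * (1 + t\<^sup>2) powr (-10/3))) (at t)" for t :: real
    using d[of "-7/3" t] by simp
  have sq: "((\<lambda>t. t\<^sup>2) has_real_derivative 2 * t) (at t)" for t :: real
    by (auto intro!: derivative_eq_intros)
  show ?thesis
    unfolding derivs3_on_def
  proof (intro ballI conjI)
    fix t :: real
    show "((\<lambda>t. (1 + t\<^sup>2) powr (-1/3)) has_real_derivative - (2/3) * (t * (1 + t\<^sup>2) powr (-4/3))) (at t)"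
      by (rule e1)
    show "((\<lambda>t. - (2/3) * (t * (1 + t\<^sup>2) powr (-4/3))) has_real_derivative
       - (2/3) * (1 + t\<^sup>2) powr (-4/3) + 16/9 * (t\<^sup>2 * (1 + t\<^sup>2) powr (-7/3))) (at t)"
      by (rule DERIV_cong[OF DERIV_cmult[OF DERIV_mult[OF DERIV_ident e2]]])
         (simp add: algebra_simps power2_eq_square)
    show "((\<lambda>t. - (2/3) * (1 + t\<^sup>2) powr (-4/3) + 16/9 * (t\<^sup>2 * (1 + t\<^sup>2) powr (-7/3))) has_real_derivative
       16/3 * (t * (1 + t\<^sup>2) powr (-7/3)) - 224/27 * (t ^ 3 * (1 + t\<^sup>2) powr (-10/3))) (at t)"
      by (rule DERIV_cong[OF DERIV_add[OF DERIV_cmult[OF e2] DERIV_cmult[OF DERIV_mult[OF sq e3]]]])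
         (simp add: algebra_simps power2_eq_square power3_eq_cube)
  qed
qed

lemma root_profile_third_derivative_bound:
  fixes t :: real
  shows "\<bar>16/3 * (t * (1 + t\<^sup>2) powr (-7/3)) - 224/27 * (t ^ 3 * (1 + t\<^sup>2) powr (-10/3))\<bar> \<le> 14"
proof -
  define v where "v = 1 + t\<^sup>2"
  have v: "v \<ge> 1" by (simp add: v_def)
  have tv: "\<bar>t\<bar> \<le> v"
    unfolding v_def by (cases "\<bar>t\<bar> \<le> 1") (auto intro: order.trans[OF self_le_power[of "\<bar>t\<bar>" 2]] simp: add_increasing2)
  have "\<bar>t\<bar> * v powr (-7/3) \<le> v powr 1 * v powr (-7/3)" using tv v by (intro mult_right_mono) auto
  also have "\<dots> = v powr (1 + -7/3)" by (rule powr_add[symmetric])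
  also have "\<dots> \<le> 1" using powr_mono[of "1 + -7/3" 0 v] v by simp
  finally have 1: "\<bar>t * v powr (-7/3)\<bar> \<le> 1" by (simp add: abs_mult)
  have "\<bar>t\<bar> ^ 3 = \<bar>t\<bar> * t\<^sup>2" by (simp add: power3_eq_cube power2_eq_square)
  also have "\<dots> \<le> v * v" using tv by (intro mult_mono) (auto simp: v_def)
  also have "\<dots> = v powr 2" using v by (simp add: powr_numeral power2_eq_square)
  finally have "\<bar>t\<bar> ^ 3 * v powr (-10/3) \<le> v powr 2 * v powr (-10/3)" by (intro mult_right_mono) auto
  also have "\<dots> = v powr (2 + -10/3)" by (rule powr_add[symmetric])
  also have "\<dots> \<le> 1" using powr_mono[of "2 + -10/3" 0 v] v by simp
  finally have 2: "\<bar>t ^ 3 * v powr (-10/3)\<bar> \<le> 1" by (simp add: abs_mult power_abs)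
  show ?thesis using 1 2 unfolding v_def by linarith
qed

text \<open>
  The bump is \<open>\<kappa> * S ^ 3 * \<phi> (t / S - 2/5)\<close> with \<open>\<phi> z = 1 / (1 + z\<^sup>2)\<^sup>2\<close>; the powers of \<open>S\<close> are chosen so
  that its third derivative is \<open>\<kappa>\<close> times that of \<open>\<phi>\<close>. The shift \<open>2/5\<close> moves \<open>\<bar>t\<bar> \<le> S / 5\<close> into
  the range \<open>[-3/5, -1/5]\<close> left of the peak, where \<open>\<phi>\<close> has a negative third derivative.
\<close>

lemma bump_derivs:
  fixes S \<kappa> :: real
  assumes "S \<noteq> 0"
  defines "x \<equiv> \<lambda>t. t / S - 2/5"
  shows "derivs3_on UNIV (\<lambda>t. \<kappa> * S ^ 3 * (1 / (1 + (x t)\<^sup>2)\<^sup>2)) (\<lambda>t. \<kappa> * S\<^sup>2 * (- 4 * (x t * (1 / (1 + (x t)\<^sup>2)) ^ 3)))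
     (\<lambda>t. \<kappa> * S * (- 4 * (1 / (1 + (x t)\<^sup>2)) ^ 3 + 24 * ((x t)\<^sup>2 * (1 / (1 + (x t)\<^sup>2)) ^ 4)))
     (\<lambda>t. \<kappa> * ((72 * x t - 120 * (x t) ^ 3) / (1 + (x t)\<^sup>2) ^ 5))"
proof -
  have dx: "(x has_real_derivative 1 / S) (at t)" for t
    unfolding x_def using \<open>S \<noteq> 0\<close> by (auto intro!: derivative_eq_intros)
  define W where "W = (\<lambda>z::real. 1 / (1 + z\<^sup>2))"
  have nz: "0 < 1 + z\<^sup>2" for z :: real by (intro add_pos_nonneg) auto
  have W1: "W z * (1 + z\<^sup>2) = 1" for z using nz[of z] by (simp add: W_def)
  have dW: "(W has_real_derivative - 2 * z * (W z)\<^sup>2) (at z)" for z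
    unfolding W_def using nz[of z]
    by (auto intro!: derivative_eq_intros simp: power2_eq_square)
  have dWn: "((\<lambda>z. W z ^ n) has_real_derivative - 2 * real n * (z * W z ^ Suc n)) (at z)" if "n > 0" for n z
    by (rule DERIV_cong[OF DERIV_power[OF dW]]) (use that in \<open>cases n; simp add: power2_eq_square algebra_simps\<close>)
  have sq: "((\<lambda>t. t\<^sup>2) has_real_derivative 2 * t) (at t)" for t :: real
    by (auto intro!: derivative_eq_intros)
  have 0: "((\<lambda>z. W z ^ 2) has_real_derivative - 4 * (z * W z ^ 3)) (at z)" for z
    by (rule DERIV_cong[OF dWn]) (auto simp: eval_nat_numeral)
  have 1: "((\<lambda>z. - 4 * (z * W z ^ 3)) has_real_derivative - 4 * W z ^ 3 + 24 * (z\<^sup>2 * W z ^ 4)) (at z)" for z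
    by (rule DERIV_cong[OF DERIV_cmult[OF DERIV_mult[OF DERIV_ident dWn]]])
       (auto simp: algebra_simps power2_eq_square eval_nat_numeral)
  have "72 * z * W z ^ 4 - 192 * z ^ 3 * W z ^ 5 = (72 * z - 120 * z ^ 3) * W z ^ 5" for z
    using W1[of z] by algebra
  then have eq: "72 * z * W z ^ 4 - 192 * z ^ 3 * W z ^ 5 = (72 * z - 120 * z ^ 3) / (1 + z\<^sup>2) ^ 5" for z
    by (simp add: W_def power_one_over)
  have 2: "((\<lambda>z. - 4 * W z ^ 3 + 24 * (z\<^sup>2 * W z ^ 4)) has_real_derivative
      (72 * z - 120 * z ^ 3) / (1 + z\<^sup>2) ^ 5) (at z)" for z
    unfolding eq[symmetric]
    by (rule DERIV_cong[OF DERIV_add[OF DERIV_cmult[OF dWn] DERIV_cmult[OF DERIV_mult[OF sq dWn]]]])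
       (auto simp: algebra_simps power2_eq_square eval_nat_numeral)
  have Weq: "1 / (1 + z\<^sup>2) = W z" for z by (simp add: W_def)
  have Weq2: "1 / (1 + z\<^sup>2)\<^sup>2 = (W z)\<^sup>2" for z by (simp add: W_def power_one_over)
  show ?thesis
    unfolding derivs3_on_def
  proof (intro ballI conjI)
    fix t :: real
    note c = DERIV_cong[OF DERIV_cmult[OF DERIV_chain2[OF _ dx[of t]]]]
    show "((\<lambda>t. \<kappa> * S ^ 3 * (1 / (1 + (x t)\<^sup>2)\<^sup>2)) has_real_derivative
        \<kappa> * S\<^sup>2 * (- 4 * (x t * (1 / (1 + (x t)\<^sup>2)) ^ 3))) (at t)"
      unfolding Weq2 Weq
      by (rule c[OF 0]) (use \<open>S \<noteq> 0\<close> in \<open>simp add: power2_eq_square power3_eq_cube\<close>)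
    show "((\<lambda>t. \<kappa> * S\<^sup>2 * (- 4 * (x t * (1 / (1 + (x t)\<^sup>2)) ^ 3))) has_real_derivative
        \<kappa> * S * (- 4 * (1 / (1 + (x t)\<^sup>2)) ^ 3 + 24 * ((x t)\<^sup>2 * (1 / (1 + (x t)\<^sup>2)) ^ 4))) (at t)"
      unfolding Weq
      by (rule c[OF 1]) (use \<open>S \<noteq> 0\<close> in \<open>simp add: power2_eq_square\<close>)
    show "((\<lambda>t. \<kappa> * S * (- 4 * (1 / (1 + (x t)\<^sup>2)) ^ 3 + 24 * ((x t)\<^sup>2 * (1 / (1 + (x t)\<^sup>2)) ^ 4))) has_real_derivative
        \<kappa> * ((72 * x t - 120 * (x t) ^ 3) / (1 + (x t)\<^sup>2) ^ 5)) (at t)"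
      unfolding Weq by (rule c[OF 2]) (use \<open>S \<noteq> 0\<close> in simp)
  qed
qed

lemma bump_third_derivative_bound:
  fixes z :: real
  shows "\<bar>(72 * z - 120 * z ^ 3) / (1 + z\<^sup>2) ^ 5\<bar> \<le> 192"
proof -
  have v: "1 \<le> 1 + z\<^sup>2" by simp
  have zv: "\<bar>z\<bar> \<le> 1 + z\<^sup>2"
    by (cases "\<bar>z\<bar> \<le> 1") (auto intro: order.trans[OF self_le_power[of "\<bar>z\<bar>" 2]] simp: add_increasing2)
  have "\<bar>z\<bar> ^ 3 \<le> (1 + z\<^sup>2) ^ 3" using zv by (intro power_mono) auto
  moreover have "(1 + z\<^sup>2) ^ 3 \<le> (1 + z\<^sup>2) ^ 5" "(1 + z\<^sup>2) ^ 1 \<le> (1 + z\<^sup>2) ^ 5"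
    by (rule power_increasing; simp)+
  ultimately have "72 * \<bar>z\<bar> + 120 * \<bar>z\<bar> ^ 3 \<le> 192 * (1 + z\<^sup>2) ^ 5"
    using zv unfolding power_one_right by linarith
  moreover have "\<bar>72 * z - 120 * z ^ 3\<bar> \<le> 72 * \<bar>z\<bar> + 120 * \<bar>z\<bar> ^ 3"
    by (rule order.trans[OF abs_triangle_ineq4]) (simp add: abs_mult power_abs)
  ultimately have "\<bar>72 * z - 120 * z ^ 3\<bar> \<le> 192 * (1 + z\<^sup>2) ^ 5" by linarith
  moreover have "(1 + z\<^sup>2) ^ 5 > 0" using v by (intro zero_less_power) linarith
  ultimately show ?thesis by (simp add: abs_divide pos_divide_le_eq)
qed

lemma bump_third_derivative_negative:
  fixes z :: real
  assumes "z \<in> {-3/5..-1/5}"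
  shows "(72 * z - 120 * z ^ 3) / (1 + z\<^sup>2) ^ 5 \<le> -1"
proof -
  have "\<bar>z\<bar> ^ 2 \<le> (3/5)\<^sup>2" using assms by (intro power_mono) auto
  then have z2: "z\<^sup>2 \<le> 9/25" by (simp add: power2_eq_square)
  have "(1 + z\<^sup>2) ^ 5 \<le> (34/25) ^ 5" using z2 by (intro power_mono) auto
  also have "\<dots> \<le> 144/25" by (simp add: power_divide)
  also have "\<dots> \<le> - z * (72 - 120 * z\<^sup>2)"
  proof -
    have "1/5 * (144/5) \<le> - z * (72 - 120 * z\<^sup>2)" using assms z2 by (intro mult_mono) auto
    then show ?thesis by simp
  qed
  finally have "(1 + z\<^sup>2) ^ 5 \<le> - (72 * z - 120 * z ^ 3)" by (simp add: algebra_simps power2_eq_square power3_eq_cube)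
  moreover have "(1 + z\<^sup>2) ^ 5 > 0" by (intro zero_less_power add_pos_nonneg) auto
  ultimately show ?thesis by (simp add: pos_divide_le_eq)
qed

lemma reciprocal_cube_diff_le:
  fixes u e :: real
  assumes "u > 0" "e \<ge> 0"
  shows "0 \<le> 1 / u ^ 3 - 1 / (u + e) ^ 3" "1 / u ^ 3 - 1 / (u + e) ^ 3 \<le> 3 * e / u ^ 4"
proof -
  define h where "h = u + e"
  have h: "h \<ge> u" "h > 0" using assms by (auto simp: h_def)
  have "u ^ 3 \<le> h ^ 3" using h assms by (intro power_mono) auto
  then show "0 \<le> 1 / u ^ 3 - 1 / (u + e) ^ 3"
    using assms h by (auto simp: h_def[symmetric] intro!: divide_left_mono)
  have "1 / u ^ 3 - 1 / h ^ 3 = e * (h\<^sup>2 + h * u + u\<^sup>2) / (u ^ 3 * h ^ 3)"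
    using assms h by (simp add: divide_simps) (simp add: h_def, algebra)
  also have "\<dots> \<le> e * (h\<^sup>2 + h * h + h\<^sup>2) / (u ^ 3 * h ^ 3)"
    using assms h by (intro divide_right_mono mult_left_mono add_mono power_mono) auto
  also have "\<dots> = 3 * e / (u ^ 3 * h)"
    using assms h by (simp add: divide_simps) algebra
  also have "\<dots> \<le> 3 * e / (u ^ 3 * u)"
    using assms h by (intro divide_left_mono mult_left_mono) auto
  also have "\<dots> = 3 * e / u ^ 4" by (simp add: power_numeral_reduce)
  finally show "1 / u ^ 3 - 1 / (u + e) ^ 3 \<le> 3 * e / u ^ 4" by (simp add: h_def)
qed

text \<open>
  The natural profile \<open>(1 + t\<^sup>2) powr (-1/3)\<close> has the right decay, but for \<open>a < 1\<close> it violates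
  \<open>1 \<le> t\<^sup>2 + a - h3 t\<close> at the origin. This last condition is what keeps a solution from being
  large at no cost in energy, so a bump is added that forces
  the third derivative below \<open>-\<bar>a\<bar>\<close> for \<open>\<bar>t\<bar> \<le> T\<close>. Elsewhere the third derivative of the bump is at most
  \<open>192 * M\<close>, which \<open>t\<^sup>2\<close> dominates once \<open>T\<close> is large; increasing \<open>T\<close> costs nothing because the
  size of the third derivative of the bump does not depend on \<open>S = 5 * T\<close>. The bump decays like \<open>1 / t ^ 4\<close>, fast enough
  not to disturb \<open>1 / h ^ 3\<close> by more than a constant.
\<close>

lemma comparison_profile_exists:
  fixes a :: real
  obtains h h1 h2 h3 :: "real \<Rightarrow> real" and C
  where "derivs3_on UNIV h h1 h2 h3" "continuous_on UNIV h3" "\<And>t. 0 < h t" "\<And>t. \<bar>h3 t\<bar> \<le> C"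
    "\<And>t. \<bar>1 / h t ^ 3 - t\<^sup>2\<bar> \<le> C" "\<And>t. 1 \<le> t\<^sup>2 + a - h3 t"
proof -
  \<comment> \<open>The constant \<open>14\<close> bounds the third derivative of the decaying part, \<open>192\<close> that of the normalised bump.\<close>
  define M where "M = \<bar>a\<bar> + 15"
  define T where "T = 193 * M"
  define S where "S = 5 * T"
  have pos: "M \<ge> 15" "T > 0" "S > 0" by (auto simp: M_def T_def S_def)
  define x where "x = (\<lambda>t::real. t / S - 2/5)"
  define u :: "real \<Rightarrow> real" where "u = (\<lambda>t. (1 + t\<^sup>2) powr (-1/3))"
  define e where "e = (\<lambda>t. M * S ^ 3 * (1 / (1 + (x t)\<^sup>2)\<^sup>2))"
  define h3 where "h3 = (\<lambda>t. 16/3 * (t * (1 + t\<^sup>2) powr (-7/3)) - 224/27 * (t ^ 3 * (1 + t\<^sup>2) powr (-10/3))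
      + M * ((72 * x t - 120 * (x t) ^ 3) / (1 + (x t)\<^sup>2) ^ 5))"
  have vp: "0 < 1 + t\<^sup>2" for t :: real by (intro add_pos_nonneg) auto
  have up: "0 < u t" and ep: "0 \<le> e t" for t using vp[of t] pos by (auto simp: u_def e_def)
  have b1: "\<bar>16/3 * (t * (1 + t\<^sup>2) powr (-7/3)) - 224/27 * (t ^ 3 * (1 + t\<^sup>2) powr (-10/3))\<bar> \<le> 14" for t :: real
    by (rule root_profile_third_derivative_bound)
  have b2: "\<bar>M * ((72 * z - 120 * z ^ 3) / (1 + z\<^sup>2) ^ 5)\<bar> \<le> 192 * M" for z
    using mult_left_mono[OF bump_third_derivative_bound[of z], of M] pos by (simp add: abs_mult)
  define C where "C = 14 + 192 * M + (1 + 3 * M * S ^ 3 * (1 + 2 * S\<^sup>2)\<^sup>2)"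
  have C: "14 + 192 * M \<le> C" "1 + 3 * M * S ^ 3 * (1 + 2 * S\<^sup>2)\<^sup>2 \<le> C" using pos by (auto simp: C_def)
  show thesis
  proof
    show "derivs3_on UNIV (\<lambda>t. u t + e t)
       (\<lambda>t. - (2/3) * (t * (1 + t\<^sup>2) powr (-4/3)) + M * S\<^sup>2 * (- 4 * (x t * (1 / (1 + (x t)\<^sup>2)) ^ 3)))
       (\<lambda>t. - (2/3) * (1 + t\<^sup>2) powr (-4/3) + 16/9 * (t\<^sup>2 * (1 + t\<^sup>2) powr (-7/3)) +
          M * S * (- 4 * (1 / (1 + (x t)\<^sup>2)) ^ 3 + 24 * ((x t)\<^sup>2 * (1 / (1 + (x t)\<^sup>2)) ^ 4))) h3"
      using root_profile_derivs bump_derivs[of S M] pos unfolding derivs3_on_def h3_def u_def e_def x_def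
      by (intro ballI conjI DERIV_add) auto
    show "continuous_on UNIV h3"
      unfolding h3_def x_def using vp pos
      by (intro continuous_intros) (auto simp: less_imp_neq[OF vp, symmetric])
    show "0 < u t + e t" for t using up[of t] ep[of t] by linarith
    show "\<bar>h3 t\<bar> \<le> C" for t unfolding h3_def using b1[of t] b2[of "x t"] C(1) by linarith
    show "\<bar>1 / (u t + e t) ^ 3 - t\<^sup>2\<bar> \<le> C" for t
    proof -
      have u3: "1 / u t ^ 3 = 1 + t\<^sup>2"
        using vp[of t] by (simp add: u_def powr_power powr_minus field_simps)
      have "1 / u t ^ 4 = (1 + t\<^sup>2) powr (4/3)"
        using powr_power[of "1 + t\<^sup>2" "-1/3" 4] vp[of t] by (simp add: u_def powr_minus_divide)
      also have "\<dots> \<le> (1 + t\<^sup>2) powr 2" by (intro powr_mono) auto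
      also have "\<dots> = (1 + t\<^sup>2)\<^sup>2" using vp[of t] by (simp add: powr_numeral)
      finally have u4: "1 / u t ^ 4 \<le> (1 + t\<^sup>2)\<^sup>2" .
      have "t = S * (x t + 2/5)" using pos by (simp add: x_def)
      then have "t\<^sup>2 = S\<^sup>2 * (x t + 2/5)\<^sup>2" by (metis power_mult_distrib)
      also have "\<dots> \<le> S\<^sup>2 * (2 * (1 + (x t)\<^sup>2))"
      proof (rule mult_left_mono)
        have "0 \<le> (x t - 2/5)\<^sup>2" by simp
        then show "(x t + 2/5)\<^sup>2 \<le> 2 * (1 + (x t)\<^sup>2)" by (simp add: power2_eq_square algebra_simps)
      qed simp
      finally have "1 + t\<^sup>2 \<le> (1 + 2 * S\<^sup>2) * (1 + (x t)\<^sup>2)"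
        by (auto simp: algebra_simps intro: add_increasing)
      then have "(1 + t\<^sup>2)\<^sup>2 \<le> ((1 + 2 * S\<^sup>2) * (1 + (x t)\<^sup>2))\<^sup>2" by (intro power_mono) auto
      then have tx: "(1 + t\<^sup>2)\<^sup>2 \<le> (1 + 2 * S\<^sup>2)\<^sup>2 * (1 + (x t)\<^sup>2)\<^sup>2" by (simp only: power_mult_distrib)
      have "3 * e t / u t ^ 4 = 3 * e t * (1 / u t ^ 4)" by simp
      also have "\<dots> \<le> 3 * e t * ((1 + 2 * S\<^sup>2)\<^sup>2 * (1 + (x t)\<^sup>2)\<^sup>2)"
        using u4 tx ep[of t] by (intro mult_left_mono) auto
      also have "\<dots> = 3 * M * S ^ 3 * (1 + 2 * S\<^sup>2)\<^sup>2"
        using vp[of "x t"] by (simp add: e_def)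
      finally have "3 * e t / u t ^ 4 \<le> 3 * M * S ^ 3 * (1 + 2 * S\<^sup>2)\<^sup>2" .
      with reciprocal_cube_diff_le[OF up[of t] ep[of t]] u3 C(2) show ?thesis by linarith
    qed
    show "1 \<le> t\<^sup>2 + a - h3 t" for t
    proof (cases "\<bar>t\<bar> \<le> T")
      case True
      then have "x t \<in> {-3/5..-1/5}"
        using pos by (auto simp: x_def S_def abs_le_iff field_simps)
      from mult_left_mono[OF bump_third_derivative_negative[OF this], of M] pos
      have "M * ((72 * x t - 120 * x t ^ 3) / (1 + (x t)\<^sup>2) ^ 5) \<le> - M" by simp
      then have "h3 t \<le> 14 - M" using b1[of t] unfolding h3_def by linarith
      moreover have "0 \<le> t\<^sup>2" by simp
      ultimately show ?thesis unfolding M_def by linarith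
    next
      case False
      then have "T\<^sup>2 \<le> t\<^sup>2" using pos by (metis abs_le_square_iff abs_of_pos linear)
      moreover have "193 * M * 1 \<le> 193 * M * (193 * M)" using pos by (intro mult_left_mono) auto
      ultimately have "193 * M \<le> t\<^sup>2" by (simp add: T_def power2_eq_square)
      moreover have "h3 t \<le> 14 + 192 * M" using b1[of t] b2[of "x t"] unfolding h3_def by linarith
      ultimately show ?thesis using abs_ge_minus_self[of a] M_def by argo
    qed
  qed
qed

section \<open>Coercivity of the energy density\<close>

text \<open>
  The singular term of the equation, truncated at height \<open>\<delta>\<close> so that it is Lipschitz.
\<close>

definition reg_cube :: "real \<Rightarrow> real \<Rightarrow> real" where
  "reg_cube \<delta> y = 1 / max y \<delta> ^ 3"

lemma reg_cube_nonneg: "0 < \<delta> \<Longrightarrow> 0 \<le> reg_cube \<delta> y"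
  by (simp add: reg_cube_def max_def)

lemma reg_cube_eq: "\<delta> \<le> y \<Longrightarrow> reg_cube \<delta> y = 1 / y ^ 3"
  by (simp add: reg_cube_def max_def)

lemma inverse_cube_diff_ge:
  fixes x z :: real
  assumes "0 < x" "x \<le> z"
  shows "(z - x) / (x * z ^ 3) \<le> 1 / x ^ 3 - 1 / z ^ 3" "(z - x) / (z * x ^ 3) \<le> 1 / x ^ 3 - 1 / z ^ 3"
proof -
  have z: "0 < z" using assms by linarith
  have e: "1 / x ^ 3 - 1 / z ^ 3 = (z - x) * (z\<^sup>2 + z * x + x\<^sup>2) / (x ^ 3 * z ^ 3)"
    using assms z by (simp add: divide_simps) algebra
  have "(z - x) / (x * z ^ 3) = (z - x) * x\<^sup>2 / (x ^ 3 * z ^ 3)"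
    using assms z by (simp add: power2_eq_square power3_eq_cube)
  also have "\<dots> \<le> 1 / x ^ 3 - 1 / z ^ 3"
    unfolding e using assms z by (intro divide_right_mono mult_left_mono) auto
  finally show "(z - x) / (x * z ^ 3) \<le> 1 / x ^ 3 - 1 / z ^ 3" .
  have "(z - x) / (z * x ^ 3) = (z - x) * z\<^sup>2 / (x ^ 3 * z ^ 3)"
    using assms z by (simp add: power2_eq_square power3_eq_cube)
  also have "\<dots> \<le> 1 / x ^ 3 - 1 / z ^ 3"
    unfolding e using assms z by (intro divide_right_mono mult_left_mono) auto
  finally show "(z - x) / (z * x ^ 3) \<le> 1 / x ^ 3 - 1 / z ^ 3" .
qed

text \<open>
  Quantitative monotonicity of \<open>y \<mapsto> - reg_cube \<delta> y\<close> around \<open>h\<close>: quadratic for small deviations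
  and linear for large ones.
\<close>

lemma monotone_gap_coercive:
  fixes h \<delta> y :: real
  assumes h: "0 < h" and \<delta>: "0 < \<delta>" "2 * \<delta> \<le> h"
  shows "\<bar>y - h\<bar> * min h \<bar>y - h\<bar> / (2 * h ^ 4) \<le> (1 / h ^ 3 - reg_cube \<delta> y) * (y - h)"
proof (cases "h \<le> y")
  case True
  then have y: "0 < y" "reg_cube \<delta> y = 1 / y ^ 3" using assms by (auto simp: reg_cube_eq)
  have "y * min h (y - h) \<le> 2 * h * (y - h)"
  proof (cases "y \<le> 2 * h")
    case le: True
    have "y * min h (y - h) \<le> 2 * h * (y - h)" by (rule mult_mono) (use le True h in auto)
    then show ?thesis .
  next
    case False
    have "y * min h (y - h) \<le> y * h" using y by (intro mult_left_mono) auto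
    also have "\<dots> \<le> 2 * h * (y - h)"
    proof -
      have "h * y \<le> h * (2 * (y - h))" using False h by (intro mult_left_mono) auto
      then show ?thesis by (simp add: algebra_simps)
    qed
    finally show ?thesis .
  qed
  then have "min h (y - h) / (2 * h ^ 4) \<le> (y - h) / (y * h ^ 3)"
    using h y by (simp add: divide_simps mult_ac power_numeral_reduce)
  also have "\<dots> \<le> 1 / h ^ 3 - 1 / y ^ 3" using inverse_cube_diff_ge(2)[OF h True] .
  finally have "(min h (y - h) / (2 * h ^ 4)) * (y - h) \<le> (1 / h ^ 3 - 1 / y ^ 3) * (y - h)"
    by (rule mult_right_mono) (use True in simp)
  then show ?thesis using True y by (simp add: mult_ac)
next
  case False
  define m where "m = max y \<delta>"
  have m: "0 < m" "m \<le> h" and hm: "min h (h - y) / 2 \<le> h - m"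
    using False assms by (auto simp: m_def max_def min_def)
  have "min h (h - y) / (2 * h ^ 4) = (min h (h - y) / 2) / (h * h ^ 3)" by (simp add: power_numeral_reduce)
  also have "\<dots> \<le> (h - m) / (h * h ^ 3)" using hm h by (intro divide_right_mono) auto
  also have "\<dots> \<le> (h - m) / (m * h ^ 3)" using m h by (intro divide_left_mono mult_right_mono) auto
  also have "\<dots> \<le> 1 / m ^ 3 - 1 / h ^ 3" by (rule inverse_cube_diff_ge(1)[OF m])
  finally have "(min h (h - y) / (2 * h ^ 4)) * (h - y) \<le> (1 / m ^ 3 - 1 / h ^ 3) * (h - y)"
    by (rule mult_right_mono) (use False in simp)
  moreover have "\<bar>y - h\<bar> = h - y" using False by simp
  moreover have "(1 / m ^ 3 - 1 / h ^ 3) * (h - y) = (1 / h ^ 3 - reg_cube \<delta> y) * (y - h)"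
    using minus_mult_minus[of "1 / h ^ 3 - 1 / m ^ 3" "y - h"] by (simp add: reg_cube_def m_def[symmetric])
  ultimately show ?thesis by (simp add: mult_ac)
qed

text \<open>
  A profile \<open>h\<close> that solves the equation \<open>y''' = t\<^sup>2 + a - 1 / y ^ 3\<close> up to a bounded error and satisfies the
  coercivity condition at large values.
\<close>

locale comparison_profile =
  fixes a C :: real and h h1 h2 h3 :: "real \<Rightarrow> real"
  assumes h_derivs: "derivs3_on UNIV h h1 h2 h3" and h3_cont: "continuous_on UNIV h3"
    and h_pos: "0 < h t" and h3_bound: "\<bar>h3 t\<bar> \<le> C"
    and h_cube: "\<bar>1 / h t ^ 3 - t\<^sup>2\<bar> \<le> C" and coercive: "1 \<le> t\<^sup>2 + a - h3 t"
begin

text \<open>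
  For a solution \<open>y\<close> of the truncated equation, \<open>energy \<delta> t (y t)\<close> is \<open>(y - h)''' * (y - h)\<close>, so its
  integral has a sign; \<open>gap\<close> is its main part, with the residual of \<open>h\<close> dropped.
\<close>

definition gap :: "real \<Rightarrow> real \<Rightarrow> real \<Rightarrow> real" where
  "gap \<delta> t y = (1 / h t ^ 3 - reg_cube \<delta> y) * (y - h t)"

definition energy :: "real \<Rightarrow> real \<Rightarrow> real \<Rightarrow> real" where
  "energy \<delta> t y = (t\<^sup>2 + a - h3 t - reg_cube \<delta> y) * (y - h t)"

text \<open>
  The last condition makes the truncated term strong enough to push back solutions that drop below \<open>\<delta>\<close>,
  negative ones included.
\<close>

definition admissible :: "real \<Rightarrow> real \<Rightarrow> bool" where
  "admissible \<delta> t \<longleftrightarrow> 0 < \<delta> \<and> 2 * \<delta> \<le> h t \<and> 2 * (t\<^sup>2 + a - h3 t) + 2 \<le> 1 / \<delta> ^ 3"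

lemma C_nonneg: "0 \<le> C" using h3_bound[of 0] by linarith

lemma h_cont: "continuous_on S h"
  using derivs3_on_continuous(1)[OF h_derivs] continuous_on_subset by blast

lemma h_bounds:
  obtains m M where "0 < m" "\<And>t. \<bar>t\<bar> \<le> R \<Longrightarrow> m \<le> h t" "\<And>t. \<bar>t\<bar> \<le> R \<Longrightarrow> h t \<le> M"
proof (cases "0 \<le> R")
  case True
  then have ne: "{-R..R} \<noteq> {}" by simp
  obtain t0 where t0: "\<And>t. t \<in> {-R..R} \<Longrightarrow> h t0 \<le> h t"
    using continuous_attains_inf[OF compact_Icc ne h_cont] by blast
  obtain t1 where t1: "\<And>t. t \<in> {-R..R} \<Longrightarrow> h t \<le> h t1"
    using continuous_attains_sup[OF compact_Icc ne h_cont] by blast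
  show thesis by (rule that[of "h t0" "h t1"]) (use t0 t1 h_pos in \<open>auto simp: abs_le_iff\<close>)
next
  case False
  show thesis by (rule that[of 1 1]) (use False in auto)
qed

lemma q_upper: "\<bar>t\<bar> \<le> R \<Longrightarrow> t\<^sup>2 + a - h3 t \<le> R\<^sup>2 + \<bar>a\<bar> + C"
proof -
  assume "\<bar>t\<bar> \<le> R"
  then have "\<bar>t\<bar>\<^sup>2 \<le> R\<^sup>2" by (intro power_mono) auto
  then show ?thesis using h3_bound[of t] by (simp add: abs_le_iff) linarith
qed

lemma admissible_small:
  obtains \<delta>0 where "0 < \<delta>0" "\<And>\<delta> t. 0 < \<delta> \<Longrightarrow> \<delta> \<le> \<delta>0 \<Longrightarrow> \<bar>t\<bar> \<le> R \<Longrightarrow> admissible \<delta> t"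
proof -
  obtain m M where m: "0 < m" "\<And>t. \<bar>t\<bar> \<le> R \<Longrightarrow> m \<le> h t" "\<And>t. \<bar>t\<bar> \<le> R \<Longrightarrow> h t \<le> M"
    by (rule h_bounds[of R]) (rule that)
  define Q where "Q = R\<^sup>2 + \<bar>a\<bar> + C"
  have Q: "0 \<le> Q" using C_nonneg by (simp add: Q_def)
  define \<delta>0 where "\<delta>0 = min (m / 2) (min 1 (1 / (2 * Q + 2)))"
  show thesis
  proof
    show "0 < \<delta>0" using m Q by (simp add: \<delta>0_def)
    fix \<delta> t assume d: "0 < \<delta>" "\<delta> \<le> \<delta>0" and t: "\<bar>t\<bar> \<le> R"
    have d': "2 * \<delta> \<le> m" "\<delta> \<le> 1" "\<delta> \<le> 1 / (2 * Q + 2)" using d by (auto simp: \<delta>0_def)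
    have "2 * Q + 2 \<le> 1 / \<delta>" using d' d Q by (simp add: field_simps)
    also have "\<dots> \<le> 1 / \<delta> ^ 3"
      using d d' power_decreasing[of 1 3 \<delta>] by (intro divide_left_mono) auto
    finally show "admissible \<delta> t"
      using d d' m(2)[OF t] q_upper[OF t] by (auto simp: admissible_def Q_def)
  qed
qed

text \<open>
  For \<open>y\<close> above \<open>h\<close> the energy grows linearly in \<open>y\<close> because \<open>t\<^sup>2 + a - h3 t \<ge> 1\<close>. For \<open>y\<close> below
  \<open>h\<close> with \<open>reg_cube \<delta> y\<close> large it controls the product of \<open>reg_cube \<delta> y\<close> and \<open>h - y\<close>. In the
  remaining cases all quantities are bounded. The constant does not depend on \<open>\<delta>\<close>.
\<close>

lemma energy_controls_locally:
  obtains K where "1 \<le> K"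
    "\<And>\<delta> t y. \<bar>t\<bar> \<le> R \<Longrightarrow> admissible \<delta> t \<Longrightarrow> \<bar>y\<bar> + reg_cube \<delta> y \<le> K * (energy \<delta> t y + K)"
proof -
  obtain m M where mM: "0 < m" "\<And>t. \<bar>t\<bar> \<le> R \<Longrightarrow> m \<le> h t" "\<And>t. \<bar>t\<bar> \<le> R \<Longrightarrow> h t \<le> M" by (rule h_bounds[of R]) (rule that)
  \<comment> \<open>The upper bound of \<open>t\<^sup>2 + a - h3 t\<close> for \<open>\<bar>t\<bar> \<le> R\<close>.\<close>
  define Q where "Q = R\<^sup>2 + \<bar>a\<bar> + C"
  have Q: "0 \<le> Q" using C_nonneg by (simp add: Q_def)
  define K where "K = 1 + 4 / m + \<bar>M\<bar> + 1 / m\<^sup>2 + 1 / m ^ 3 + 8 / m ^ 3 + (2 * Q + 2) + Q * \<bar>M\<bar>"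
  have K: "1 + 4 / m \<le> K" "\<bar>M\<bar> + 1 / m\<^sup>2 + 1 / m ^ 3 \<le> K" "\<bar>M\<bar> + 8 / m ^ 3 + Q * \<bar>M\<bar> \<le> K"
    "\<bar>M\<bar> + (2 * Q + 2) + Q * \<bar>M\<bar> \<le> K" "1 \<le> K"
  proof -
    have "0 \<le> 4 / m" "0 \<le> 1 / m\<^sup>2" "0 \<le> 1 / m ^ 3" "0 \<le> 8 / m ^ 3" "0 \<le> Q * \<bar>M\<bar>"
      using mM(1) Q by auto
    then show "1 + 4 / m \<le> K" "\<bar>M\<bar> + 1 / m\<^sup>2 + 1 / m ^ 3 \<le> K" "\<bar>M\<bar> + 8 / m ^ 3 + Q * \<bar>M\<bar> \<le> K"
      "\<bar>M\<bar> + (2 * Q + 2) + Q * \<bar>M\<bar> \<le> K" "1 \<le> K"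
      using Q unfolding K_def by linarith+
  qed
  show thesis
  proof
    show "1 \<le> K" by (rule K)
    fix \<delta> t y assume t: "\<bar>t\<bar> \<le> R" and ad: "admissible \<delta> t"
    define q where "q = t\<^sup>2 + a - h3 t"
    define r where "r = reg_cube \<delta> y"
    define E where "E = energy \<delta> t y"
    have E: "E = (q - r) * (y - h t)" by (simp add: E_def energy_def q_def r_def)
    have q: "1 \<le> q" "q \<le> Q" using coercive q_upper[OF t] by (auto simp: q_def Q_def)
    have h: "m \<le> h t" "h t \<le> M" "0 < h t" using mM t h_pos by auto
    have M: "\<bar>M\<bar> = M" using h by simp
    have \<delta>: "0 < \<delta>" "2 * \<delta> \<le> h t" "2 * q + 2 \<le> 1 / \<delta> ^ 3" using ad by (auto simp: admissible_def q_def)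
    have r0: "0 \<le> r" using \<delta> by (simp add: r_def reg_cube_nonneg)
    \<comment> \<open>Since the left side is nonnegative and \<open>1 \<le> K\<close>, a bound by \<open>E + K\<close> is enough; only the
       last case, where the truncated nonlinearity is large, uses the factor \<open>K\<close>.\<close>
    have suff: "\<bar>y\<bar> + r \<le> K * (E + K)" if "\<bar>y\<bar> + r \<le> E + K"
    proof -
      have "1 * (E + K) \<le> K * (E + K)" using that r0 K(5) by (intro mult_right_mono) auto
      then show ?thesis using that by simp
    qed
    have "\<bar>y\<bar> + r \<le> K * (E + K)"
    proof (cases "h t \<le> y")
      case True
      then have y: "0 < y" "m \<le> y" "r = 1 / y ^ 3" using h \<delta> by (auto simp: r_def reg_cube_eq)
      have "1 * (y - h t) \<le> q * (y - h t)" using q True by (intro mult_right_mono) auto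
      also have "\<dots> = E + r * (y - h t)" by (simp add: E algebra_simps)
      also have "r * (y - h t) \<le> r * y" using r0 h by (intro mult_left_mono) auto
      also have "r * y = 1 / y\<^sup>2" using y by (simp add: power2_eq_square power3_eq_cube)
      also have "1 / y\<^sup>2 \<le> 1 / m\<^sup>2" using y mM(1) by (intro divide_left_mono power_mono) auto
      finally have "y \<le> E + M + 1 / m\<^sup>2" using h by simp
      moreover have "r \<le> 1 / m ^ 3" unfolding y(3) using y mM(1) by (intro divide_left_mono power_mono) auto
      ultimately have "\<bar>y\<bar> + r \<le> E + K" using y K(2) M by linarith
      then show ?thesis by (rule suff)
    next
      case False
      have lowE: "- (Q * M) \<le> E" if "0 \<le> y"
      proof -
        have "q * (h t - y) \<le> Q * M" using q h that False by (intro mult_mono) auto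
        moreover have "0 \<le> r * (h t - y)" using r0 False by simp
        ultimately show ?thesis by (simp add: E algebra_simps)
      qed
      consider "r < 2 * q + 2" | "2 * q + 2 \<le> r" "h t / 2 \<le> y" | "2 * q + 2 \<le> r" "y < h t / 2" by linarith
      then show ?thesis
      proof cases
        case 1
        have "\<delta> < y"
        proof (rule ccontr)
          assume "\<not> \<delta> < y"
          then have "r = 1 / \<delta> ^ 3" by (simp add: r_def reg_cube_def max_def)
          with 1 \<delta> show False by simp
        qed
        then show ?thesis using 1 q lowE \<delta> False h K(4) M by (intro suff) linarith
      next
        case 2
        have "r \<le> 1 / (m / 2) ^ 3"
          unfolding r_def reg_cube_def using 2 h mM(1) \<delta> by (intro divide_left_mono power_mono) auto
        then have "r \<le> 8 / m ^ 3" by (simp add: power_divide)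
        then show ?thesis using 2 h lowE K(3) M False by (intro suff) linarith
      next
        case 3
        have E': "E = (r - q) * (h t - y)" by (simp add: E algebra_simps)
        have "1 * (h t - y) \<le> E" unfolding E' using 3 q False by (intro mult_right_mono) auto
        then have yE: "\<bar>y\<bar> \<le> E" using 3(2) h(3) by (simp add: abs_le_iff)
        have "r / 2 * (m / 2) \<le> E" unfolding E' using 3 q h mM(1) by (intro mult_mono) auto
        then have "r \<le> 4 / m * E" using mM(1) by (simp add: field_simps)
        with yE have "\<bar>y\<bar> + r \<le> (1 + 4 / m) * E" by (simp add: algebra_simps)
        also have "\<dots> \<le> K * (E + K)" using K yE mM(1) by (intro mult_mono) auto
        finally show ?thesis .
      qed
    qed
    then show "\<bar>y\<bar> + reg_cube \<delta> y \<le> K * (energy \<delta> t y + K)" by (simp add: r_def E_def)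
  qed
qed

text \<open>
  The energy is \<open>gap\<close> plus the bounded residual \<open>\<rho>\<close> times the deviation. Far out \<open>h\<close> is small, so
  the coefficients in \<open>monotone_gap_coercive\<close> are large and absorb half of the residual term; what
  is left over is \<open>c\<^sup>2 * h ^ 4\<close>, which decays like \<open>\<bar>t\<bar> powr (-8/3)\<close> and is bounded by a multiple of the
  integrable function \<open>1 / (1 + t\<^sup>2)\<close>. Near the
  origin \<open>energy_controls_locally\<close> bounds the energy below by a constant.
\<close>

lemma energy_controls_gap_far:
  obtains T\<^sub>1 C\<^sub>4 where "0 \<le> C\<^sub>4"
    "\<And>\<delta> t y. admissible \<delta> t \<Longrightarrow> 0 \<le> energy \<delta> t y + C\<^sub>4 / (1 + t\<^sup>2)"
    "\<And>\<delta> t y. admissible \<delta> t \<Longrightarrow> T\<^sub>1 \<le> \<bar>t\<bar> \<Longrightarrow> gap \<delta> t y \<le> 2 * (energy \<delta> t y + C\<^sub>4 / (1 + t\<^sup>2))"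
proof -
  define c where "c = 2 * C + \<bar>a\<bar>"
  have c: "0 \<le> c" using C_nonneg by (simp add: c_def)
  \<comment> \<open>Beyond \<open>T\<^sub>1\<close> both \<open>1 / h ^ 3 \<ge> (1 + t\<^sup>2) / 2\<close> and \<open>1 / h ^ 3 \<ge> 4 * c\<close>.\<close>
  define T\<^sub>1 where "T\<^sub>1 = 1 + 2 * C + 4 * c"
  have T1: "1 \<le> T\<^sub>1" using c C_nonneg by (simp add: T\<^sub>1_def)
  have far: "gap \<delta> t y \<le> 2 * (energy \<delta> t y + 4 * c\<^sup>2 / (1 + t\<^sup>2))"
    if ad: "admissible \<delta> t" and t: "T\<^sub>1 \<le> \<bar>t\<bar>" for \<delta> t y
  proof -
    have \<delta>: "0 < \<delta>" "2 * \<delta> \<le> h t" using ad by (auto simp: admissible_def)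
    have "T\<^sub>1 * 1 \<le> \<bar>t\<bar> * \<bar>t\<bar>" using t T1 by (intro mult_mono) auto
    then have tt: "1 + 2 * C + 4 * c \<le> t\<^sup>2" by (simp add: T\<^sub>1_def power2_eq_square)
    have big: "(1 + t\<^sup>2) / 2 \<le> 1 / h t ^ 3" "4 * c \<le> 1 / h t ^ 3"
      using h_cube[of t] tt C_nonneg c by (auto simp: abs_le_iff)
    have vp: "0 < 1 + t\<^sup>2" by (intro add_pos_nonneg) auto
    have h3: "h t ^ 3 \<le> 2 / (1 + t\<^sup>2)" using big(1) vp h_pos[of t] by (simp add: field_simps)
    also have "\<dots> \<le> 2" using vp by (simp add: divide_simps)
    finally have "h t ^ 3 \<le> 2 ^ 3" by simp
    then have h2: "h t \<le> 2" using power_le_imp_le_base[of "h t" 2 2] by (simp add: eval_nat_numeral)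
    have "h t ^ 4 = h t * h t ^ 3" by (simp add: power_numeral_reduce)
    also have "\<dots> \<le> 2 * (2 / (1 + t\<^sup>2))" using h2 h3 h_pos[of t] by (intro mult_mono) auto
    finally have h4: "h t ^ 4 \<le> 4 / (1 + t\<^sup>2)" by simp
    define w where "w = \<bar>y - h t\<bar>"
    define \<rho> where "\<rho> = t\<^sup>2 + a - h3 t - 1 / h t ^ 3"
    have \<rho>: "\<bar>\<rho>\<bar> \<le> c" using h_cube[of t] h3_bound[of t] unfolding \<rho>_def c_def by linarith
    have E: "energy \<delta> t y = gap \<delta> t y + \<rho> * (y - h t)" by (simp add: energy_def gap_def \<rho>_def algebra_simps)
    have gap: "w * min (h t) w / (2 * h t ^ 4) \<le> gap \<delta> t y"
      unfolding w_def gap_def by (rule monotone_gap_coercive[OF h_pos \<delta>])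
    have "c * w \<le> gap \<delta> t y / 2 + c\<^sup>2 * h t ^ 4"
    proof (cases "h t \<le> w")
      case True
      have "c * w \<le> 1 / h t ^ 3 / 4 * w" using big(2) by (intro mult_right_mono) (auto simp: w_def)
      also have "\<dots> = w * min (h t) w / (2 * h t ^ 4) / 2"
        using True h_pos[of t] by (simp add: min_absorb1 power_numeral_reduce)
      also have "\<dots> \<le> gap \<delta> t y / 2" using gap by simp
      also have "\<dots> \<le> gap \<delta> t y / 2 + c\<^sup>2 * h t ^ 4" using h_pos[of t] by simp
      finally show ?thesis .
    next
      case False
      \<comment> \<open>Completing the square in \<open>c * (h t)\<^sup>2 * s\<close>.\<close>
      define s where "s = w / h t ^ 2"
      have w: "w = s * (h t)\<^sup>2" using h_pos[of t] by (simp add: s_def)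
      have h4e: "h t ^ 4 = (h t)\<^sup>2 * (h t)\<^sup>2" by (simp add: power_numeral_reduce)
      have "0 \<le> (s / 2 - c * (h t)\<^sup>2)\<^sup>2" by simp
      then have "c * (h t)\<^sup>2 * s \<le> s\<^sup>2 / 4 + c\<^sup>2 * h t ^ 4"
        by (simp add: power2_eq_square h4e field_simps)
      moreover have "s\<^sup>2 / 4 = w * min (h t) w / (2 * h t ^ 4) / 2"
        using False h_pos[of t] by (simp add: min_absorb2 s_def power_divide power2_eq_square power_numeral_reduce)
      ultimately show ?thesis using gap by (simp add: w mult_ac)
    qed
    moreover have "\<bar>\<rho> * (y - h t)\<bar> \<le> c * w" unfolding abs_mult w_def using \<rho> by (intro mult_right_mono) auto
    moreover have "c\<^sup>2 * h t ^ 4 \<le> 4 * c\<^sup>2 / (1 + t\<^sup>2)" using mult_left_mono[OF h4, of "c\<^sup>2"] by (simp add: mult_ac)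
    ultimately have "\<bar>\<rho> * (y - h t)\<bar> \<le> gap \<delta> t y / 2 + 4 * c\<^sup>2 / (1 + t\<^sup>2)" by (meson add_left_mono order.trans)
    then have "- (\<rho> * (y - h t)) \<le> gap \<delta> t y / 2 + 4 * c\<^sup>2 / (1 + t\<^sup>2)" by (simp only: abs_le_iff)
    then show ?thesis unfolding E by (simp add: field_simps)
  qed
  obtain K where K: "1 \<le> K" "\<And>\<delta> t y. \<bar>t\<bar> \<le> T\<^sub>1 \<Longrightarrow> admissible \<delta> t \<Longrightarrow> \<bar>y\<bar> + reg_cube \<delta> y \<le> K * (energy \<delta> t y + K)"
    by (rule energy_controls_locally[of T\<^sub>1]) (rule that)
  define C\<^sub>4 where "C\<^sub>4 = 4 * c\<^sup>2 + K * (1 + T\<^sub>1\<^sup>2)"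
  have C4: "0 \<le> C\<^sub>4" "4 * c\<^sup>2 \<le> C\<^sub>4" "K * (1 + T\<^sub>1\<^sup>2) \<le> C\<^sub>4" using K(1) by (auto simp: C\<^sub>4_def)
  have vp: "0 < 1 + t\<^sup>2" for t :: real by (intro add_pos_nonneg) auto
  have far': "gap \<delta> t y \<le> 2 * (energy \<delta> t y + C\<^sub>4 / (1 + t\<^sup>2))"
    if "admissible \<delta> t" "T\<^sub>1 \<le> \<bar>t\<bar>" for \<delta> t y
  proof -
    have "4 * c\<^sup>2 / (1 + t\<^sup>2) \<le> C\<^sub>4 / (1 + t\<^sup>2)"
      by (rule divide_right_mono[OF C4(2)]) (use vp[of t] in simp)
    then have "2 * (energy \<delta> t y + 4 * c\<^sup>2 / (1 + t\<^sup>2)) \<le> 2 * (energy \<delta> t y + C\<^sub>4 / (1 + t\<^sup>2))"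
      by simp
    with far[OF that, of y] show ?thesis by (rule order.trans)
  qed
  show thesis
  proof
    show "0 \<le> C\<^sub>4" by (rule C4)
    fix \<delta> t y assume ad: "admissible \<delta> t"
    then have \<delta>: "0 < \<delta>" "2 * \<delta> \<le> h t" by (auto simp: admissible_def)
    show "0 \<le> energy \<delta> t y + C\<^sub>4 / (1 + t\<^sup>2)"
    proof (cases "\<bar>t\<bar> \<le> T\<^sub>1")
      case True
      have "0 \<le> K * (energy \<delta> t y + K)" using K(2)[OF True ad, of y] reg_cube_nonneg[OF \<delta>(1), of y] by linarith
      then have "- K \<le> energy \<delta> t y" using K(1) by (simp add: zero_le_mult_iff)
      moreover have "K \<le> C\<^sub>4 / (1 + t\<^sup>2)"
      proof -
        have "\<bar>t\<bar>\<^sup>2 \<le> T\<^sub>1\<^sup>2" using True by (intro power_mono) auto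
        then have "K * (1 + t\<^sup>2) \<le> K * (1 + T\<^sub>1\<^sup>2)" using K(1) by (intro mult_left_mono) auto
        then show ?thesis using C4 vp[of t] by (simp add: pos_le_divide_eq)
      qed
      ultimately show ?thesis by linarith
    next
      case False
      have "0 \<le> \<bar>y - h t\<bar> * min (h t) \<bar>y - h t\<bar> / (2 * h t ^ 4)" using h_pos[of t] by simp
      then have "0 \<le> gap \<delta> t y" using monotone_gap_coercive[OF h_pos \<delta>, of y] by (simp add: gap_def)
      then show ?thesis using far'[OF ad, of y] False by simp
    qed
  qed (rule far')
qed

end

section \<open>Uniform estimates on large intervals\<close>

lemma reg_cube_antimono: "0 < \<delta> \<Longrightarrow> x \<le> y \<Longrightarrow> reg_cube \<delta> y \<le> reg_cube \<delta> x"
  unfolding reg_cube_def by (intro divide_left_mono power_mono) auto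

lemma reg_cube_lipschitz:
  assumes "0 < \<delta>"
  shows "\<bar>reg_cube \<delta> x - reg_cube \<delta> y\<bar> \<le> 3 / \<delta> ^ 4 * \<bar>x - y\<bar>"
proof -
  have *: "\<bar>reg_cube \<delta> x - reg_cube \<delta> y\<bar> \<le> 3 / \<delta> ^ 4 * \<bar>x - y\<bar>" if "x \<le> y" for x y
  proof -
    define u where "u = max x \<delta>"
    define e where "e = max y \<delta> - u"
    have u: "\<delta> \<le> u" "0 < u" and e: "0 \<le> e" "e \<le> \<bar>x - y\<bar>" using that assms by (auto simp: u_def e_def)
    have "max y \<delta> = u + e" by (simp add: e_def)
    then have "\<bar>reg_cube \<delta> x - reg_cube \<delta> y\<bar> = 1 / u ^ 3 - 1 / (u + e) ^ 3"
      using reciprocal_cube_diff_le(1)[OF u(2) e(1)] by (simp add: reg_cube_def u_def)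
    also have "\<dots> \<le> 3 * e / u ^ 4" by (rule reciprocal_cube_diff_le(2)[OF u(2) e(1)])
    also have "\<dots> \<le> 3 * \<bar>x - y\<bar> / \<delta> ^ 4" using u e assms by (intro frac_le mult_left_mono power_mono) auto
    finally show ?thesis by simp
  qed
  show ?thesis
  proof (cases "x \<le> y")
    case False
    then show ?thesis using *[of y x] by (simp add: abs_minus_commute)
  qed (rule *)
qed

lemma continuous_on_reg_cube [continuous_intros]:
  assumes "0 < \<delta>" "continuous_on S f"
  shows "continuous_on S (\<lambda>x. reg_cube \<delta> (f x))"
  unfolding reg_cube_def using assms
  by (intro continuous_intros) (auto simp: max_def split: if_splits)

text \<open>
  The additional constants are those provided by \<open>energy_controls_gap_far\<close>; fixing them here lets the
  estimates below share them.
\<close>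

locale coercive_profile = comparison_profile +
  fixes T\<^sub>1 C\<^sub>4 :: real
  assumes C4_nonneg: "0 \<le> C\<^sub>4"
    and energy_nonneg: "admissible \<delta> t \<Longrightarrow> 0 \<le> energy \<delta> t y + C\<^sub>4 / (1 + t\<^sup>2)"
    and gap_le_energy: "admissible \<delta> t \<Longrightarrow> T\<^sub>1 \<le> \<bar>t\<bar> \<Longrightarrow> gap \<delta> t y \<le> 2 * (energy \<delta> t y + C\<^sub>4 / (1 + t\<^sup>2))"
begin

text \<open>
  The bound in the last clause involves neither \<open>R\<close> nor \<open>\<delta>\<close>; this is what makes the later
  estimates uniform.
\<close>

definition approx_solution where
  "approx_solution R \<delta> y y1 y2 \<longleftrightarrow> 1 \<le> R \<and> (\<forall>t. \<bar>t\<bar> \<le> R \<longrightarrow> admissible \<delta> t) \<and>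
     derivs3_on {-R..R} y y1 y2 (\<lambda>t. t\<^sup>2 + a - reg_cube \<delta> (y t)) \<and>
     (\<forall>c d. {c..d} \<subseteq> {-R..R} \<longrightarrow>
       integral {c..d} (\<lambda>t. energy \<delta> t (y t) + C\<^sub>4 / (1 + t\<^sup>2)) \<le> C\<^sub>4 * pi)"

lemma one_plus_square_pos: "0 < 1 + (t::real)\<^sup>2" by (intro add_pos_nonneg) auto

lemma energy_continuous:
  assumes "0 < \<delta>" "continuous_on S y"
  shows "continuous_on S (\<lambda>t. energy \<delta> t (y t) + C\<^sub>4 / (1 + t\<^sup>2))"
  unfolding energy_def
  by (intro continuous_intros assms h_cont continuous_on_subset[OF h3_cont])
     (auto simp: less_imp_neq[OF one_plus_square_pos, symmetric])

text \<open>
  The energy integrates to a nonpositive number over \<open>[-R, R]\<close>. Adding \<open>C\<^sub>4 / (1 + t\<^sup>2)\<close>, of total mass at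
  most \<open>C\<^sub>4 * pi\<close>, makes the integrand nonnegative, so the bound passes to subintervals.
\<close>

lemma approx_solution_exists:
  assumes "1 \<le> R" and ad: "\<And>t. \<bar>t\<bar> \<le> R \<Longrightarrow> admissible \<delta> t"
  obtains y y1 y2 where "approx_solution R \<delta> y y1 y2"
proof -
  have \<delta>: "0 < \<delta>" using ad[of 0] \<open>1 \<le> R\<close> by (simp add: admissible_def)
  define F where "F = (\<lambda>t y. t\<^sup>2 + a - reg_cube \<delta> y)"
  have "-R < R" using \<open>1 \<le> R\<close> by simp
  moreover have "continuous_on ({-R..R} \<times> UNIV) (\<lambda>(t, x). F t x)"
    unfolding F_def case_prod_beta by (intro continuous_intros \<delta>)
  moreover have "\<bar>F t x - F t y\<bar> \<le> 3 / \<delta> ^ 4 * \<bar>x - y\<bar>" for t x y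
    using reg_cube_lipschitz[OF \<delta>, of y x] by (simp add: F_def abs_minus_commute)
  moreover have "x \<le> y \<Longrightarrow> F t x \<le> F t y" for t x y
    using reg_cube_antimono[OF \<delta>] by (simp add: F_def)
  ultimately obtain y y1 y2 where bc: "y (-R) = h (-R)" "y1 (-R) = h1 (-R)" "y R = h R"
    and y: "derivs3_on {-R..R} y y1 y2 (\<lambda>t. F t (y t))"
    by (rule third_order_bvp[where y\<^sub>a = "h (-R)" and p\<^sub>a = "h1 (-R)" and y\<^sub>b = "h R"])
  have yc: "continuous_on {-R..R} y" by (rule derivs3_on_continuous(1)[OF y])
  define E where "E = (\<lambda>t. energy \<delta> t (y t) + C\<^sub>4 / (1 + t\<^sup>2))"
  have "((\<lambda>t. (F t (y t) - h3 t) * (y t - h t)) has_integral - (y1 R - h1 R)\<^sup>2 / 2) {-R..R}"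
    by (rule skew_energy_identity[OF derivs3_on_diff[OF y derivs3_on_subset[OF h_derivs]]])
       (use bc \<open>1 \<le> R\<close> in auto)
  then have I1: "((\<lambda>t. energy \<delta> t (y t)) has_integral - (y1 R - h1 R)\<^sup>2 / 2) {-R..R}"
    by (rule has_integral_eq[rotated]) (simp add: energy_def F_def algebra_simps)
  have I2: "((\<lambda>t. C\<^sub>4 / (1 + t\<^sup>2)) has_integral (C\<^sub>4 * arctan R - C\<^sub>4 * arctan (-R))) {-R..R}"
    by (rule fundamental_theorem_of_calculus)
       (use \<open>1 \<le> R\<close> in \<open>auto intro!: derivative_eq_intros simp: has_real_derivative_iff_has_vector_derivative[symmetric] divide_simps\<close>)
  have EI: "(E has_integral (- (y1 R - h1 R)\<^sup>2 / 2 + (C\<^sub>4 * arctan R - C\<^sub>4 * arctan (-R)))) {-R..R}"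
    unfolding E_def by (rule has_integral_add[OF I1 I2])
  have total: "integral {-R..R} E \<le> C\<^sub>4 * pi"
  proof -
    have "arctan R - arctan (-R) \<le> pi" using arctan_ubound[of R] by (simp add: arctan_minus)
    from mult_left_mono[OF this C4_nonneg]
    have "C\<^sub>4 * arctan R - C\<^sub>4 * arctan (-R) \<le> C\<^sub>4 * pi" by (simp add: algebra_simps)
    moreover have "0 \<le> (y1 R - h1 R)\<^sup>2" by simp
    ultimately show ?thesis unfolding integral_unique[OF EI] by linarith
  qed
  have "integral {c..d} E \<le> C\<^sub>4 * pi" if cd: "{c..d} \<subseteq> {-R..R}" for c d
  proof -
    have "integral {c..d} E \<le> integral {-R..R} E"
    proof (rule integral_subset_le[OF cd])
      show "E integrable_on {c..d}" unfolding E_def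
        by (intro integrable_continuous_real energy_continuous \<delta> continuous_on_subset[OF yc cd])
      show "E integrable_on {-R..R}" using EI by blast
      show "\<forall>t\<in>{-R..R}. 0 \<le> E t"
        unfolding E_def by (intro ballI energy_nonneg ad) auto
    qed
    with total show ?thesis by linarith
  qed
  then have "approx_solution R \<delta> y y1 y2"
    using \<open>1 \<le> R\<close> ad y unfolding approx_solution_def F_def E_def by blast
  then show thesis by (rule that)
qed

lemma unit_interval_around:
  assumes "1 \<le> T" "\<bar>t\<bar> \<le> T"
  obtains c where "{c..c + 1} \<subseteq> {-T..T}" "t \<in> {c..c + (1::real)}"
proof (cases "t \<le> 0")
  case True
  then show thesis using assms by (intro that[of t]) auto
next
  case False
  then show thesis using assms by (intro that[of "t - 1"]) auto
qed

text \<open>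
  On a unit interval the energy bounds the integrals of \<open>\<bar>y\<bar>\<close> and of \<open>reg_cube \<delta> y\<close>, hence that
  of the third derivative, and interpolation does the rest. The bound depends on \<open>T\<close> only.
\<close>

lemma local_derivative_bounds:
  assumes "1 \<le> T"
  obtains M where "0 < M"
    "\<And>R \<delta> y y1 y2 t. approx_solution R \<delta> y y1 y2 \<Longrightarrow> T \<le> R \<Longrightarrow> \<bar>t\<bar> \<le> T \<Longrightarrow>
       \<bar>y t\<bar> \<le> M \<and> \<bar>y1 t\<bar> \<le> M \<and> \<bar>y2 t\<bar> \<le> M"
    "\<And>R \<delta> y y1 y2 c. approx_solution R \<delta> y y1 y2 \<Longrightarrow> T \<le> R \<Longrightarrow> {c..c + 1} \<subseteq> {-T..T} \<Longrightarrow>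
       integral {c..c + 1} (\<lambda>t. reg_cube \<delta> (y t)) \<le> M"
proof -
  obtain K where K: "1 \<le> K"
    "\<And>\<delta> t y. \<bar>t\<bar> \<le> T \<Longrightarrow> admissible \<delta> t \<Longrightarrow> \<bar>y\<bar> + reg_cube \<delta> y \<le> K * (energy \<delta> t y + K)"
    by (rule energy_controls_locally[of T]) (rule that)
  define K1 where "K1 = K * (C\<^sub>4 * pi + K)"
  define K2 where "K2 = T\<^sup>2 + \<bar>a\<bar> + K1"
  have K1: "0 < K1" using K(1) C4_nonneg by (auto simp: K1_def intro!: mult_pos_pos add_nonneg_pos)
  have K2: "K1 \<le> K2" by (simp add: K2_def)
  have bnd: "integral {c..c + 1} (\<lambda>t. \<bar>y t\<bar>) \<le> K2 \<and> integral {c..c + 1} (\<lambda>t. reg_cube \<delta> (y t)) \<le> K1 \<and>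
      integral {c..c + 1} (\<lambda>t. \<bar>t\<^sup>2 + a - reg_cube \<delta> (y t)\<bar>) \<le> K2 \<and>
      derivs3_on {c..c + 1} y y1 y2 (\<lambda>t. t\<^sup>2 + a - reg_cube \<delta> (y t)) \<and>
      continuous_on {c..c + 1} (\<lambda>t. t\<^sup>2 + a - reg_cube \<delta> (y t))"
    if ap: "approx_solution R \<delta> y y1 y2" and "T \<le> R" and c: "{c..c + 1} \<subseteq> {-T..T}" for R \<delta> y y1 y2 c
  proof -
    have cR: "{c..c + 1} \<subseteq> {-R..R}" using c \<open>T \<le> R\<close> by auto
    have ad: "admissible \<delta> t" if "\<bar>t\<bar> \<le> R" for t using ap that by (simp add: approx_solution_def)
    have \<delta>: "0 < \<delta>" using ad[of 0] assms \<open>T \<le> R\<close> by (simp add: admissible_def)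
    have d: "derivs3_on {c..c + 1} y y1 y2 (\<lambda>t. t\<^sup>2 + a - reg_cube \<delta> (y t))"
      using ap cR derivs3_on_subset unfolding approx_solution_def by blast
    have yc: "continuous_on {c..c + 1} y" by (rule derivs3_on_continuous(1)[OF d])
    define E where "E = (\<lambda>t. energy \<delta> t (y t) + C\<^sub>4 / (1 + t\<^sup>2))"
    have Ec: "continuous_on {c..c + 1} E" unfolding E_def by (intro energy_continuous \<delta> yc)
    have le: "\<bar>y t\<bar> + reg_cube \<delta> (y t) \<le> K * (E t + K)" if t: "t \<in> {c..c + 1}" for t
    proof -
      have tT: "\<bar>t\<bar> \<le> T" using subsetD[OF c t] by (simp add: abs_le_iff)
      have "\<bar>y t\<bar> + reg_cube \<delta> (y t) \<le> K * (energy \<delta> t (y t) + K)"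
        by (rule K(2)[OF tT ad]) (use tT \<open>T \<le> R\<close> in simp)
      also have "\<dots> \<le> K * (E t + K)"
        using K(1) C4_nonneg by (intro mult_left_mono) (auto simp: E_def intro!: divide_nonneg_nonneg add_nonneg_nonneg)
      finally show ?thesis .
    qed
    have "integral {c..c + 1} (\<lambda>t. \<bar>y t\<bar> + reg_cube \<delta> (y t)) \<le> integral {c..c + 1} (\<lambda>t. K * (E t + K))"
      by (rule integral_le) (auto intro!: integrable_continuous_real continuous_intros \<delta> yc Ec le)
    also have "\<dots> = K * integral {c..c + 1} E + K * K"
      using Henstock_Kurzweil_Integration.integral_add[of "\<lambda>t. K * E t" "{c..c+1}" "\<lambda>_. K * K"]
      by (simp add: distrib_left integrable_continuous_real continuous_intros Ec)
    also have "\<dots> \<le> K * (C\<^sub>4 * pi) + K * K"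
      using ap cR K(1) unfolding approx_solution_def E_def by (intro add_right_mono mult_left_mono) auto
    finally have s: "integral {c..c + 1} (\<lambda>t. \<bar>y t\<bar> + reg_cube \<delta> (y t)) \<le> K1"
      by (simp add: K1_def algebra_simps)
    have "integral {c..c + 1} (\<lambda>t. \<bar>y t\<bar>) \<le> integral {c..c + 1} (\<lambda>t. \<bar>y t\<bar> + reg_cube \<delta> (y t))"
      "integral {c..c + 1} (\<lambda>t. reg_cube \<delta> (y t)) \<le> integral {c..c + 1} (\<lambda>t. \<bar>y t\<bar> + reg_cube \<delta> (y t))"
      by (rule integral_le; auto intro!: integrable_continuous_real continuous_intros \<delta> yc reg_cube_nonneg)+
    then have i: "integral {c..c + 1} (\<lambda>t. \<bar>y t\<bar>) \<le> K1" "integral {c..c + 1} (\<lambda>t. reg_cube \<delta> (y t)) \<le> K1"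
      using s by linarith+
    have "integral {c..c + 1} (\<lambda>t. \<bar>t\<^sup>2 + a - reg_cube \<delta> (y t)\<bar>)
        \<le> integral {c..c + 1} (\<lambda>t. T\<^sup>2 + \<bar>a\<bar> + reg_cube \<delta> (y t))"
    proof (rule integral_le)
      fix t assume "t \<in> {c..c + 1}"
      from subsetD[OF c this] have "\<bar>t\<bar> \<le> T" by (simp add: abs_le_iff)
      then have "\<bar>t\<bar>\<^sup>2 \<le> T\<^sup>2" by (intro power_mono) auto
      moreover have "0 \<le> t\<^sup>2" by simp
      ultimately show "\<bar>t\<^sup>2 + a - reg_cube \<delta> (y t)\<bar> \<le> T\<^sup>2 + \<bar>a\<bar> + reg_cube \<delta> (y t)"
        using reg_cube_nonneg[OF \<delta>, of "y t"] abs_ge_self[of a] abs_ge_minus_self[of a]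
        unfolding abs_le_iff power2_abs by (intro conjI; linarith)
    qed (auto intro!: integrable_continuous_real continuous_intros \<delta> yc)
    also have "\<dots> = T\<^sup>2 + \<bar>a\<bar> + integral {c..c + 1} (\<lambda>t. reg_cube \<delta> (y t))"
      using Henstock_Kurzweil_Integration.integral_add[of "\<lambda>_. T\<^sup>2 + \<bar>a\<bar>" "{c..c+1}" "\<lambda>t. reg_cube \<delta> (y t)"]
      by (simp add: integrable_continuous_real continuous_intros \<delta> yc)
    finally have "integral {c..c + 1} (\<lambda>t. \<bar>t\<^sup>2 + a - reg_cube \<delta> (y t)\<bar>) \<le> K2" using i by (simp add: K2_def)
    moreover have "continuous_on {c..c + 1} (\<lambda>t. t\<^sup>2 + a - reg_cube \<delta> (y t))"
      by (intro continuous_intros \<delta> yc)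
    ultimately show ?thesis using i K2 d by linarith
  qed
  show thesis
  proof
    show "0 < 1478 * K2" using K1 K2 by simp
    fix R \<delta> y y1 y2 assume ap: "approx_solution R \<delta> y y1 y2" and TR: "T \<le> R"
    show "\<bar>y t\<bar> \<le> 1478 * K2 \<and> \<bar>y1 t\<bar> \<le> 1478 * K2 \<and> \<bar>y2 t\<bar> \<le> 1478 * K2" if "\<bar>t\<bar> \<le> T" for t
    proof -
      obtain c where c: "{c..c + 1} \<subseteq> {-T..T}" "t \<in> {c..c + 1}"
        by (rule unit_interval_around[OF assms \<open>\<bar>t\<bar> \<le> T\<close>])
      note b = bnd[OF ap TR c(1)]
      have "\<bar>y t\<bar> \<le> 1478 * K2" "\<bar>y1 t\<bar> \<le> 1471 * K2 / 1" "\<bar>y2 t\<bar> \<le> 1373 * K2 / 1\<^sup>2"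
        by (rule derivatives_bounded_by_integrals[of c 1 y y1 y2 "\<lambda>t. t\<^sup>2 + a - reg_cube \<delta> (y t)"];
            use b c in simp)+
      then show ?thesis using K1 K2 by auto
    qed
    show "integral {c..c + 1} (\<lambda>t. reg_cube \<delta> (y t)) \<le> 1478 * K2" if "{c..c + 1} \<subseteq> {-T..T}" for c
      using bnd[OF ap TR that] K1 K2 by auto
  qed
qed

text \<open>
  The alternative in the hypothesis is needed because the lemma is used twice: with small \<open>\<delta>\<close>
  to show that the truncation is inactive, and then, for solutions known to be untruncated, with
  \<open>T\<close> much smaller than \<open>R\<close>, where \<open>\<delta>\<close> depends on \<open>R\<close> and cannot be compared with \<open>\<epsilon>\<close>.
\<close>

lemma local_lower_bound:
  assumes "1 \<le> T"
  obtains \<epsilon> where "0 < \<epsilon>"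
    "\<And>R \<delta> y y1 y2 t. approx_solution R \<delta> y y1 y2 \<Longrightarrow> T \<le> R \<Longrightarrow>
       \<delta> \<le> \<epsilon> \<or> (\<forall>t. \<bar>t\<bar> \<le> R \<longrightarrow> \<delta> \<le> y t) \<Longrightarrow> \<bar>t\<bar> \<le> T \<Longrightarrow> \<epsilon> \<le> y t"
proof -
  obtain M where M: "0 < M"
    "\<And>R \<delta> y y1 y2 t. approx_solution R \<delta> y y1 y2 \<Longrightarrow> T \<le> R \<Longrightarrow> \<bar>t\<bar> \<le> T \<Longrightarrow>
       \<bar>y t\<bar> \<le> M \<and> \<bar>y1 t\<bar> \<le> M \<and> \<bar>y2 t\<bar> \<le> M"
    "\<And>R \<delta> y y1 y2 c. approx_solution R \<delta> y y1 y2 \<Longrightarrow> T \<le> R \<Longrightarrow> {c..c + 1} \<subseteq> {-T..T} \<Longrightarrow>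
       integral {c..c + 1} (\<lambda>t. reg_cube \<delta> (y t)) \<le> M"
    using local_derivative_bounds[OF assms] by metis
  define \<epsilon> where "\<epsilon> = min (M / 2) (1 / (4 * M))"
  have \<epsilon>: "0 < \<epsilon>" "2 * \<epsilon> \<le> M" using M(1) by (auto simp: \<epsilon>_def)
  have \<epsilon>8: "8 * M * M * \<epsilon>\<^sup>2 < 1"
  proof -
    have "\<epsilon>\<^sup>2 \<le> (1 / (4 * M))\<^sup>2" using \<epsilon> by (intro power_mono) (auto simp: \<epsilon>_def)
    then have "8 * M * M * \<epsilon>\<^sup>2 \<le> 8 * M * M * (1 / (4 * M))\<^sup>2" using M(1) by (intro mult_left_mono) auto
    also have "\<dots> < 1" using M(1) by (simp add: power2_eq_square)
    finally show ?thesis .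
  qed
  show thesis
  proof
    show "0 < \<epsilon>" by (rule \<epsilon>)
    fix R \<delta> y y1 y2 t
    assume ap: "approx_solution R \<delta> y y1 y2" and TR: "T \<le> R" and tT: "\<bar>t\<bar> \<le> T"
      and or: "\<delta> \<le> \<epsilon> \<or> (\<forall>t. \<bar>t\<bar> \<le> R \<longrightarrow> \<delta> \<le> y t)"
    have \<delta>: "0 < \<delta>" using ap assms TR unfolding approx_solution_def admissible_def
      by (metis abs_zero order.trans zero_le_one)
    obtain c where c: "{c..c + 1} \<subseteq> {-T..T}" "t \<in> {c..c + 1}"
      by (rule unit_interval_around[OF assms tT])
    have d: "derivs3_on {c..c + 1} y y1 y2 (\<lambda>t. t\<^sup>2 + a - reg_cube \<delta> (y t))"
      using ap derivs3_on_subset[of "{-R..R}" y y1 y2 _ "{c..c+1}"] c(1) TR unfolding approx_solution_def by force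
    show "\<epsilon> \<le> y t"
    proof (rule lower_bound_from_integral[OF derivs3_onD(1)[OF d] _ _ _ _ _ \<epsilon> \<epsilon>8 c(2)])
      show "continuous_on {c..c + 1} (\<lambda>t. reg_cube \<delta> (y t))"
        by (intro continuous_intros \<delta> derivs3_on_continuous(1)[OF d])
      show "integral {c..c + 1} (\<lambda>t. reg_cube \<delta> (y t)) \<le> M" by (rule M(3)[OF ap TR c(1)])
      fix x assume "x \<in> {c..c + 1}"
      from subsetD[OF c(1) this] have x: "\<bar>x\<bar> \<le> T" by (simp add: abs_le_iff)
      show "\<bar>y1 x\<bar> \<le> M" using M(2)[OF ap TR x] by simp
      show "0 \<le> reg_cube \<delta> (y x)" by (rule reg_cube_nonneg[OF \<delta>])
      show "1 / (2 * \<epsilon>) ^ 3 \<le> reg_cube \<delta> (y x)" if "y x \<le> 2 * \<epsilon>"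
      proof -
        have "\<delta> \<le> \<epsilon> \<or> \<delta> \<le> y x" using or x TR by auto
        then have "max (y x) \<delta> \<le> 2 * \<epsilon>" using that \<epsilon>(1) by auto
        then show ?thesis unfolding reg_cube_def using \<delta> \<epsilon>(1)
          by (intro divide_left_mono power_mono) (auto intro!: mult_pos_pos zero_less_power simp: max_def)
      qed
    qed
  qed
qed

text \<open>
  The lower bound \<open>\<epsilon>\<close> is independent of \<open>\<delta>\<close>, so choosing \<open>\<delta> \<le> \<epsilon>\<close> afterwards removes the truncation.
\<close>

lemma untruncated_solution_exists:
  assumes "1 \<le> R"
  obtains \<delta> y y1 y2 where "approx_solution R \<delta> y y1 y2" "\<And>t. \<bar>t\<bar> \<le> R \<Longrightarrow> \<delta> \<le> y t"
proof -
  obtain \<epsilon> where \<epsilon>: "0 < \<epsilon>"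
    "\<And>R' \<delta> y y1 y2 t. approx_solution R' \<delta> y y1 y2 \<Longrightarrow> R \<le> R' \<Longrightarrow>
       \<delta> \<le> \<epsilon> \<or> (\<forall>t. \<bar>t\<bar> \<le> R' \<longrightarrow> \<delta> \<le> y t) \<Longrightarrow> \<bar>t\<bar> \<le> R \<Longrightarrow> \<epsilon> \<le> y t"
    using local_lower_bound[OF assms] by metis
  obtain \<delta>0 where \<delta>0: "0 < \<delta>0" "\<And>\<delta> t. 0 < \<delta> \<Longrightarrow> \<delta> \<le> \<delta>0 \<Longrightarrow> \<bar>t\<bar> \<le> R \<Longrightarrow> admissible \<delta> t"
    using admissible_small[of R] by metis
  define \<delta> where "\<delta> = min \<delta>0 \<epsilon>"
  have \<delta>: "0 < \<delta>" "\<delta> \<le> \<delta>0" "\<delta> \<le> \<epsilon>" using \<delta>0 \<epsilon> by (auto simp: \<delta>_def)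
  obtain y y1 y2 where y: "approx_solution R \<delta> y y1 y2"
    by (rule approx_solution_exists[OF assms \<delta>0(2)[OF \<delta>(1,2)]])
  show thesis
  proof (rule that[OF y])
    fix t assume "\<bar>t\<bar> \<le> R"
    then have "\<epsilon> \<le> y t" using \<epsilon>(2)[OF y order.refl] \<delta>(3) by blast
    with \<delta>(3) show "\<delta> \<le> y t" by linarith
  qed
qed

end

section \<open>Asymptotics, uniformly in the interval\<close>

text \<open>
  In units where the expected height is \<open>1\<close>, \<open>U\<close> is the solution, \<open>V\<close> the profile and \<open>g\<close> the forcing;
  \<open>g - 1 / U ^ 3\<close> is then the third derivative. Deviations of \<open>U\<close> from \<open>V\<close> of size below \<open>\<mu>\<close> are harmless,
  larger ones are paid for by the gap \<open>D\<close>.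
\<close>

lemma scaled_residual_bound:
  fixes U V g \<theta> \<mu> :: real
  assumes U: "0 < U" and V: "0 < V" "\<bar>1 / V ^ 3 - 1\<bar> \<le> \<theta>" and g: "\<bar>g - 1\<bar> \<le> \<theta>"
    and \<theta>: "\<theta> \<le> 1/2" and \<mu>: "0 < \<mu>" "\<mu> \<le> 1/4"
  defines "D \<equiv> (1 / V ^ 3 - 1 / U ^ 3) * (U - V)"
  shows "\<bar>g - 1 / U ^ 3\<bar> \<le> 2 * \<theta> + 768 * \<mu> + 32 * D / \<mu>" "\<bar>U - 1\<bar> \<le> 2 * \<theta> + 768 * \<mu> + 32 * D / \<mu>"
proof -
  have "1/2 \<le> 1 / V ^ 3" "1 / V ^ 3 \<le> 3/2" using V(2) \<theta> by (auto simp: abs_le_iff)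
  then have V3: "V ^ 3 \<le> 2" "2/3 \<le> V ^ 3" using V(1) by (auto simp: field_simps)
  have "V ^ Suc 2 \<le> 2 ^ Suc 2" using V3(1) by simp
  then have V2: "V \<le> 2" by (rule power_le_imp_le_base) simp
  have "(1/2) ^ Suc 2 \<le> V ^ Suc 2" using V3(2) by (simp add: power_divide eval_nat_numeral)
  then have Vh: "1/2 \<le> V" by (rule power_le_imp_le_base) (use V in simp)
  have V1: "\<bar>V - 1\<bar> \<le> 2 * \<theta>"
  proof -
    have "V ^ 3 - 1 = (V - 1) * (V\<^sup>2 + V + 1)" by (simp add: power2_eq_square power3_eq_cube algebra_simps)
    then have "\<bar>V - 1\<bar> * (V\<^sup>2 + V + 1) = \<bar>V ^ 3 - 1\<bar>" using V(1) by (simp add: abs_mult)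
    moreover have "\<bar>V - 1\<bar> * 1 \<le> \<bar>V - 1\<bar> * (V\<^sup>2 + V + 1)" using V(1) by (intro mult_left_mono) auto
    ultimately have "\<bar>V - 1\<bar> \<le> \<bar>V ^ 3 - 1\<bar>" by simp
    also have "V ^ 3 - 1 = V ^ 3 * (1 - 1 / V ^ 3)" using V(1) by (simp add: field_simps)
    also have "\<bar>\<dots>\<bar> = V ^ 3 * \<bar>1 / V ^ 3 - 1\<bar>" using V(1) by (simp add: abs_mult abs_minus_commute)
    also have "\<dots> \<le> 2 * \<theta>" using V3(1) V by (intro mult_mono) auto
    finally show ?thesis .
  qed
  define w where "w = \<bar>U - V\<bar>"
  define d where "d = \<bar>1 / V ^ 3 - 1 / U ^ 3\<bar>"
  have gap: "w * min V w / (2 * V ^ 4) \<le> D"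
  proof -
    \<comment> \<open>A truncation that is inactive at \<open>U\<close>.\<close>
    define \<delta> where "\<delta> = min U (V / 2)"
    have "0 < \<delta>" "2 * \<delta> \<le> V" "\<delta> \<le> U" using U V(1) by (auto simp: \<delta>_def)
    then show ?thesis using monotone_gap_coercive[OF V(1), of \<delta> U] by (simp add: reg_cube_eq w_def D_def)
  qed
  have "0 \<le> w * min V w / (2 * V ^ 4)" using V(1) by (simp add: w_def)
  then have D: "0 \<le> D" "0 \<le> D / \<mu>" using gap \<mu>(1) by auto
  have "w \<le> \<mu> + 32 * D / \<mu> \<and> d \<le> 768 * \<mu> + D / \<mu>"
  proof (cases "w \<le> \<mu>")
    case True
    define u where "u = min U V"
    have u: "1/4 \<le> u" using True \<mu> Vh by (auto simp: u_def w_def abs_le_iff)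
    have d: "d \<le> 3 * w / u ^ 4"
    proof (cases "V \<le> U")
      case True
      then show ?thesis using reciprocal_cube_diff_le[OF V(1), of w]
        by (simp add: d_def u_def w_def min_absorb2)
    next
      case False
      then show ?thesis using reciprocal_cube_diff_le[OF U, of w]
        by (simp add: d_def u_def w_def min_absorb1 abs_minus_commute)
    qed
    also have "\<dots> \<le> 3 * \<mu> / (1/4) ^ 4"
      using True u by (intro frac_le mult_left_mono power_mono) (auto simp: w_def)
    finally show ?thesis using True D by (simp add: power_divide)
  next
    case False
    have w: "0 < w" using False \<mu> by linarith
    have "V ^ 4 \<le> 2 ^ 4" using V2 V(1) by (intro power_mono) auto
    then have "w * \<mu> / (2 * 16) \<le> w * min V w / (2 * V ^ 4)"
      using False V(1) Vh \<mu> w by (intro frac_le mult_left_mono) (auto intro!: mult_pos_pos)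
    then have "w * \<mu> / (2 * 16) \<le> D" using gap by (rule order.trans)
    then have "w * \<mu> \<le> 32 * D" by simp
    then have 1: "w \<le> 32 * D / \<mu>" using \<mu> by (simp add: pos_le_divide_eq)
    have "d * w = D" using D(1) by (simp add: d_def w_def D_def abs_mult[symmetric])
    moreover have "d * \<mu> \<le> d * w" using False by (intro mult_left_mono) (auto simp: d_def)
    ultimately have "d \<le> D / \<mu>" using \<mu> by (simp add: pos_le_divide_eq)
    with 1 \<mu> show ?thesis by simp
  qed
  then have w: "w \<le> \<mu> + 32 * D / \<mu>" and d: "d \<le> 768 * \<mu> + D / \<mu>" by auto
  have "\<bar>U - 1\<bar> \<le> w + \<bar>V - 1\<bar>" unfolding w_def by linarith
  then show "\<bar>U - 1\<bar> \<le> 2 * \<theta> + 768 * \<mu> + 32 * D / \<mu>" using w V1 \<mu> by linarith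
  have "\<bar>g - 1 / U ^ 3\<bar> \<le> \<bar>g - 1\<bar> + \<bar>1 / V ^ 3 - 1\<bar> + d" unfolding d_def by linarith
  moreover have "32 * D / \<mu> = 32 * (D / \<mu>)" by simp
  ultimately show "\<bar>g - 1 / U ^ 3\<bar> \<le> 2 * \<theta> + 768 * \<mu> + 32 * D / \<mu>" using d V(2) g D by linarith
qed

context coercive_profile
begin

text \<open>
  At the point \<open>t\<close> the expected height is \<open>k ^ 3 = \<bar>t\<bar> powr (-2/3)\<close>, and \<open>l = k ^ 4\<close> is the length over which
  a third derivative of size \<open>1 / height ^ 3\<close> changes the solution by the height itself, since
  \<open>l ^ 3 = height ^ 4\<close>. A relative deviation of order one over this
  length would need an integral of \<open>gap\<close> of order \<open>l / height\<^sup>2 = k powi (-2)\<close>, which tends to infinity, whereas the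
  integral available is bounded. This is why the last term carries the factor \<open>k\<^sup>2\<close>.
\<close>

lemma approx_solution_close_to_scale:
  assumes ap: "approx_solution R \<delta> y y1 y2" and above: "\<And>t. \<bar>t\<bar> \<le> R \<Longrightarrow> \<delta> \<le> y t"
    and k: "0 < k" "k \<le> 1" and s: "t\<^sup>2 * k ^ 9 = 1"
    and t: "T\<^sub>1 + 1 \<le> \<bar>t\<bar>" "\<bar>t\<bar> + 1 \<le> R"
    and \<theta>: "(2 * \<bar>t\<bar> + 1 + \<bar>a\<bar> + C) * k ^ 9 \<le> \<theta>" "\<theta> \<le> 1/2" and \<mu>: "0 < \<mu>" "\<mu> \<le> 1/4"
  shows "\<bar>y t / k ^ 3 - 1\<bar> \<le> 1478 * (2 * \<theta> + 768 * \<mu> + 64 * C\<^sub>4 * pi / \<mu> * k\<^sup>2)"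
proof -
  define I where "I = {t..t + k ^ 4}"
  define D where "D = (\<lambda>\<tau>. 2 * (energy \<delta> \<tau> (y \<tau>) + C\<^sub>4 / (1 + \<tau>\<^sup>2)))"
  define B where "B = 2 * \<theta> + 768 * \<mu>"
  define \<kappa> where "\<kappa> = B + 64 * C\<^sub>4 * pi / \<mu> * k\<^sup>2"
  have l: "0 < k ^ 4" "k ^ 4 \<le> 1" using k by (auto intro: power_le_one)
  have ad: "admissible \<delta> \<tau>" if "\<bar>\<tau>\<bar> \<le> R" for \<tau> using ap that by (simp add: approx_solution_def)
  have \<delta>: "0 < \<delta>" using ad[of t] t by (simp add: admissible_def)
  have I: "\<bar>\<tau>\<bar> \<le> R" "T\<^sub>1 \<le> \<bar>\<tau>\<bar>" "\<bar>\<tau>\<^sup>2 - t\<^sup>2\<bar> \<le> 2 * \<bar>t\<bar> + 1" if "\<tau> \<in> I" for \<tau>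
  proof -
    have \<tau>: "\<bar>\<tau> - t\<bar> \<le> 1" "\<bar>\<tau> + t\<bar> \<le> 2 * \<bar>t\<bar> + 1" using that l by (auto simp: I_def)
    then show "\<bar>\<tau>\<bar> \<le> R" "T\<^sub>1 \<le> \<bar>\<tau>\<bar>" using t by linarith+
    have "\<tau>\<^sup>2 - t\<^sup>2 = (\<tau> - t) * (\<tau> + t)" by (simp add: power2_eq_square algebra_simps)
    then have "\<bar>\<tau>\<^sup>2 - t\<^sup>2\<bar> = \<bar>\<tau> - t\<bar> * \<bar>\<tau> + t\<bar>" by (simp add: abs_mult)
    also have "\<dots> \<le> 1 * (2 * \<bar>t\<bar> + 1)" using \<tau> by (intro mult_mono) auto
    finally show "\<bar>\<tau>\<^sup>2 - t\<^sup>2\<bar> \<le> 2 * \<bar>t\<bar> + 1" by simp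
  qed
  have IR: "I \<subseteq> {-R..R}" using I(1) by (fastforce simp: abs_le_iff)
  have d: "derivs3_on I y y1 y2 (\<lambda>t. t\<^sup>2 + a - reg_cube \<delta> (y t))"
    using ap derivs3_on_subset IR unfolding approx_solution_def by blast
  have yc: "continuous_on I y" by (rule derivs3_on_continuous(1)[OF d])
  have Dc: "continuous_on I D" unfolding D_def
    by (intro continuous_on_mult continuous_on_const energy_continuous \<delta> yc)
  have intD: "integral I D \<le> 2 * (C\<^sub>4 * pi)"
  proof -
    have "integral I D = 2 * integral I (\<lambda>\<tau>. energy \<delta> \<tau> (y \<tau>) + C\<^sub>4 / (1 + \<tau>\<^sup>2))"
      unfolding D_def by (rule integral_mult_right)
    also have "\<dots> \<le> 2 * (C\<^sub>4 * pi)"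
      using ap IR unfolding approx_solution_def I_def by (intro mult_left_mono) auto
    finally show ?thesis .
  qed
  have pw: "\<bar>y \<tau> - k ^ 3\<bar> \<le> k ^ 3 * (B + 32 / \<mu> * k ^ 6 * D \<tau>)"
    "\<bar>\<tau>\<^sup>2 + a - reg_cube \<delta> (y \<tau>)\<bar> \<le> (B + 32 / \<mu> * k ^ 6 * D \<tau>) / k ^ 9" if \<tau>: "\<tau> \<in> I" for \<tau>
  proof -
    define U where "U = y \<tau> / k ^ 3"
    define V where "V = h \<tau> / k ^ 3"
    define g where "g = k ^ 9 * (\<tau>\<^sup>2 + a)"
    define G where "G = (1 / V ^ 3 - 1 / U ^ 3) * (U - V)"
    have y: "\<delta> \<le> y \<tau>" using above I(1)[OF \<tau>] by simp
    have k9: "k ^ 9 = (k ^ 3) ^ 3" "0 < k ^ 9" using k power_mult[of k 3 3] by simp_all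
    have k9': "k ^ 9 = k ^ 3 * k ^ 6" using power_add[of k 3 6] by simp
    have UV: "0 < U" "0 < V" using y \<delta> h_pos k by (auto simp: U_def V_def)
    have V3: "1 / V ^ 3 = k ^ 9 * (1 / h \<tau> ^ 3)" and U3: "1 / U ^ 3 = k ^ 9 * reg_cube \<delta> (y \<tau>)"
      unfolding V_def U_def k9(1) reg_cube_eq[OF y] by (simp_all add: power_divide)
    have small: "\<bar>k ^ 9 * z - 1\<bar> \<le> \<theta>" if "\<bar>z - t\<^sup>2\<bar> \<le> 2 * \<bar>t\<bar> + 1 + \<bar>a\<bar> + C" for z
    proof -
      have "k ^ 9 * z - 1 = k ^ 9 * (z - t\<^sup>2)" using s by (simp add: algebra_simps)
      then have "\<bar>k ^ 9 * z - 1\<bar> = k ^ 9 * \<bar>z - t\<^sup>2\<bar>" using k9(2) by (simp add: abs_mult)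
      also have "\<dots> \<le> k ^ 9 * (2 * \<bar>t\<bar> + 1 + \<bar>a\<bar> + C)" using that k9(2) by (intro mult_left_mono) auto
      finally show ?thesis using \<theta>(1) by (simp add: mult.commute)
    qed
    have "\<bar>1 / V ^ 3 - 1\<bar> \<le> \<theta>"
      unfolding V3 using h_cube[of \<tau>] I(3)[OF \<tau>] by (intro small) linarith
    moreover have "\<bar>g - 1\<bar> \<le> \<theta>"
      unfolding g_def using C_nonneg I(3)[OF \<tau>] by (intro small) linarith
    ultimately have b: "\<bar>g - 1 / U ^ 3\<bar> \<le> B + 32 * G / \<mu>" "\<bar>U - 1\<bar> \<le> B + 32 * G / \<mu>"
      unfolding B_def G_def by (rule scaled_residual_bound[OF UV(1,2) _ _ \<theta>(2) \<mu>])+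
    have "G = k ^ 9 * (1 / h \<tau> ^ 3 - reg_cube \<delta> (y \<tau>)) * ((y \<tau> - h \<tau>) / k ^ 3)"
      unfolding G_def V3 U3 by (simp add: U_def V_def algebra_simps diff_divide_distrib)
    also have "\<dots> = k ^ 6 * gap \<delta> \<tau> (y \<tau>)"
    proof -
      have "(k ^ 3 * z) * A * (w / k ^ 3) = z * (A * w)" for z A w using k by simp
      then show ?thesis unfolding k9' gap_def .
    qed
    also have "\<dots> \<le> k ^ 6 * D \<tau>"
      unfolding D_def using k by (intro mult_left_mono gap_le_energy ad I \<tau>) simp
    finally have "32 * G / \<mu> \<le> 32 / \<mu> * k ^ 6 * D \<tau>" using \<mu> by (simp add: divide_right_mono)
    with b have b': "\<bar>g - 1 / U ^ 3\<bar> \<le> B + 32 / \<mu> * k ^ 6 * D \<tau>" "\<bar>U - 1\<bar> \<le> B + 32 / \<mu> * k ^ 6 * D \<tau>"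
      by linarith+
    have "y \<tau> - k ^ 3 = k ^ 3 * (U - 1)" using k by (simp add: U_def algebra_simps)
    then have "\<bar>y \<tau> - k ^ 3\<bar> = k ^ 3 * \<bar>U - 1\<bar>" using k by (simp add: abs_mult)
    also have "\<dots> \<le> k ^ 3 * (B + 32 / \<mu> * k ^ 6 * D \<tau>)" using b'(2) k by (intro mult_left_mono) auto
    finally show "\<bar>y \<tau> - k ^ 3\<bar> \<le> k ^ 3 * (B + 32 / \<mu> * k ^ 6 * D \<tau>)" .
    have "g - 1 / U ^ 3 = k ^ 9 * (\<tau>\<^sup>2 + a - reg_cube \<delta> (y \<tau>))" unfolding U3 by (simp add: g_def algebra_simps)
    then have "\<bar>\<tau>\<^sup>2 + a - reg_cube \<delta> (y \<tau>)\<bar> * k ^ 9 = \<bar>g - 1 / U ^ 3\<bar>" using k9(2) by (simp add: abs_mult)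
    with b'(1) show "\<bar>\<tau>\<^sup>2 + a - reg_cube \<delta> (y \<tau>)\<bar> \<le> (B + 32 / \<mu> * k ^ 6 * D \<tau>) / k ^ 9"
      using k9(2) by (simp add: pos_le_divide_eq)
  qed
  have bulk: "integral I (\<lambda>\<tau>. B + 32 / \<mu> * k ^ 6 * D \<tau>) \<le> \<kappa> * k ^ 4"
  proof -
    have "(\<lambda>\<tau>. 32 / \<mu> * k ^ 6 * D \<tau>) integrable_on I"
      using Dc unfolding I_def by (intro integrable_continuous_real continuous_on_mult continuous_on_const)
    then have "integral I (\<lambda>\<tau>. B + 32 / \<mu> * k ^ 6 * D \<tau>)
        = integral I (\<lambda>_. B) + integral I (\<lambda>\<tau>. 32 / \<mu> * k ^ 6 * D \<tau>)"
      by (intro Henstock_Kurzweil_Integration.integral_add) (simp_all add: I_def integrable_const_ivl)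
    also have "\<dots> = B * k ^ 4 + 32 / \<mu> * k ^ 6 * integral I D"
    proof -
      have "integral I (\<lambda>_. B) = B * k ^ 4" using l by (simp add: I_def mult.commute)
      moreover have "integral I (\<lambda>\<tau>. 32 / \<mu> * k ^ 6 * D \<tau>) = 32 / \<mu> * k ^ 6 * integral I D"
        by (rule integral_mult_right)
      ultimately show ?thesis by simp
    qed
    also have "\<dots> \<le> B * k ^ 4 + 32 / \<mu> * k ^ 6 * (2 * (C\<^sub>4 * pi))"
      using intD \<mu> k by (intro add_left_mono mult_left_mono) auto
    also have "\<dots> = \<kappa> * k ^ 4"
    proof -
      have "B * q + 32 / \<mu> * (r * q) * (2 * (C\<^sub>4 * pi)) = (B + 64 * C\<^sub>4 * pi / \<mu> * r) * q" for q r
        by (simp add: algebra_simps)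
      from this[of "k ^ 4" "k\<^sup>2"] show ?thesis unfolding \<kappa>_def power_add[symmetric] by simp
    qed
    finally show ?thesis .
  qed
  have cont3: "continuous_on I (\<lambda>\<tau>. \<tau>\<^sup>2 + a - reg_cube \<delta> (y \<tau>))" by (intro continuous_intros \<delta> yc)
  define P where "P = (\<lambda>\<tau>. B + 32 / \<mu> * k ^ 6 * D \<tau>)"
  have Pc: "continuous_on I P" unfolding P_def by (intro continuous_on_add continuous_on_mult continuous_on_const Dc)
  have intP: "integral I P \<le> \<kappa> * k ^ 4" using bulk unfolding P_def .
  have pw': "\<bar>y \<tau> - k ^ 3\<bar> \<le> k ^ 3 * P \<tau>" "\<bar>\<tau>\<^sup>2 + a - reg_cube \<delta> (y \<tau>)\<bar> \<le> P \<tau> / k ^ 9"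
    if "\<tau> \<in> I" for \<tau>
    unfolding P_def by (rule pw[OF that])+
  have int: "f integrable_on I" if "continuous_on I f" for f :: "real \<Rightarrow> real"
    using that by (simp add: I_def integrable_continuous_real)
  have "integral I (\<lambda>\<tau>. \<bar>y \<tau> - k ^ 3\<bar>) \<le> integral I (\<lambda>\<tau>. k ^ 3 * P \<tau>)"
    by (rule integral_le) (auto intro!: int continuous_intros yc Pc pw'(1))
  also have "\<dots> = k ^ 3 * integral I P" by (rule integral_mult_right)
  also have "\<dots> \<le> k ^ 3 * (\<kappa> * k ^ 4)" using intP k by (intro mult_left_mono) auto
  finally have i0: "integral I (\<lambda>\<tau>. \<bar>y \<tau> - k ^ 3\<bar>) \<le> (k ^ 3 * \<kappa>) * k ^ 4" by (simp only: mult.assoc)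
  have "integral I (\<lambda>\<tau>. \<bar>\<tau>\<^sup>2 + a - reg_cube \<delta> (y \<tau>)\<bar>) \<le> integral I (\<lambda>\<tau>. P \<tau> / k ^ 9)"
  proof (rule integral_le)
    show "(\<lambda>\<tau>. \<bar>\<tau>\<^sup>2 + a - reg_cube \<delta> (y \<tau>)\<bar>) integrable_on I"
      by (intro int continuous_on_rabs cont3)
    show "(\<lambda>\<tau>. P \<tau> / k ^ 9) integrable_on I"
      by (intro int continuous_on_divide Pc continuous_on_const) (use k in simp)
  qed (rule pw'(2))
  also have "\<dots> = integral I P / k ^ 9" by (rule integral_divide)
  also have "\<dots> \<le> (\<kappa> * k ^ 4) / k ^ 9" using intP k by (intro divide_right_mono) auto
  also have "\<dots> = (k ^ 3 * \<kappa>) / (k ^ 4)\<^sup>2" 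
  proof -
    have "(\<kappa> * p) / (p * z) = (q * \<kappa>) / (q * z)" if "p \<noteq> 0" "q \<noteq> 0" for p q z :: real
      using that by simp
    from this[of "k ^ 4" "k ^ 3" "k ^ 5"] show ?thesis
      using k unfolding power_add[symmetric] power_mult[symmetric] by simp
  qed
  finally have i3: "integral I (\<lambda>\<tau>. \<bar>\<tau>\<^sup>2 + a - reg_cube \<delta> (y \<tau>)\<bar>) \<le> (k ^ 3 * \<kappa>) / (k ^ 4)\<^sup>2" .
  have const: "derivs3_on I (\<lambda>_. k ^ 3) (\<lambda>_. 0) (\<lambda>_. 0) (\<lambda>_. 0)" by (simp add: derivs3_on_def)
  have "\<bar>y t - k ^ 3\<bar> \<le> 1478 * (k ^ 3 * \<kappa>)"
    by (rule derivatives_bounded_by_integrals(1)[OF derivs3_on_diff[OF d const, unfolded I_def] l(1)])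
       (use i0 i3 cont3 l in \<open>auto simp: I_def\<close>)
  then have "\<bar>y t / k ^ 3 - 1\<bar> \<le> 1478 * \<kappa>"
  proof -
    have "y t / k ^ 3 - 1 = (y t - k ^ 3) / k ^ 3" using k by (simp add: field_simps)
    then have "\<bar>y t / k ^ 3 - 1\<bar> = \<bar>y t - k ^ 3\<bar> / k ^ 3" using k by (simp add: abs_divide)
    also have "\<dots> \<le> 1478 * (k ^ 3 * \<kappa>) / k ^ 3"
      using \<open>\<bar>y t - k ^ 3\<bar> \<le> 1478 * (k ^ 3 * \<kappa>)\<close> k by (intro divide_right_mono) auto
    also have "\<dots> = 1478 * \<kappa>" using k by simp
    finally show ?thesis .
  qed
  then show ?thesis by (simp add: \<kappa>_def B_def)
qed

lemma approx_solution_asymptotics: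
  assumes "0 < \<eta>"
  obtains T where
    "\<And>R \<delta> y y1 y2 t. approx_solution R \<delta> y y1 y2 \<Longrightarrow> (\<And>t. \<bar>t\<bar> \<le> R \<Longrightarrow> \<delta> \<le> y t) \<Longrightarrow>
       T \<le> \<bar>t\<bar> \<Longrightarrow> \<bar>t\<bar> + 1 \<le> R \<Longrightarrow> \<bar>y t * \<bar>t\<bar> powr (2/3) - 1\<bar> \<le> \<eta>"
proof -
  \<comment> \<open>Half of \<open>\<eta>\<close> goes to the terms in \<open>\<mu>\<close> (with \<open>\<theta> = \<mu>\<close>), half to the term in \<open>k\<^sup>2\<close>.\<close>
  define \<mu> where "\<mu> = min (1/4) (\<eta> / (1478 * 770 * 2))"
  have \<mu>: "0 < \<mu>" "\<mu> \<le> 1/4" "770 * \<mu> \<le> \<eta> / 2956" using assms by (auto simp: \<mu>_def)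
  define G where "G = 64 * C\<^sub>4 * pi / \<mu>"
  have G: "0 \<le> G" using C4_nonneg \<mu> by (simp add: G_def)
  have "((\<lambda>s::real. G * s powr (-4/9)) \<longlongrightarrow> G * 0) at_top"
    by (intro tendsto_intros tendsto_neg_powr filterlim_ident) simp
  then have "eventually (\<lambda>s. G * s powr (-4/9) < \<eta> / 2956) at_top"
    by (rule order_tendstoD) (use assms in simp)
  then obtain S where S: "\<And>s. S \<le> s \<Longrightarrow> G * s powr (-4/9) < \<eta> / 2956"
    by (auto simp: eventually_at_top_linorder)
  define c where "c = 3 + \<bar>a\<bar> + C"
  define T where "T = max (max 1 S) (max (T\<^sub>1 + 1) (c / \<mu>))"
  show thesis
  proof
    fix R \<delta> y y1 y2 t
    assume ap: "approx_solution R \<delta> y y1 y2" and above: "\<And>t. \<bar>t\<bar> \<le> R \<Longrightarrow> \<delta> \<le> y t"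
      and tT: "T \<le> \<bar>t\<bar>" and tR: "\<bar>t\<bar> + 1 \<le> R"
    define s where "s = \<bar>t\<bar>"
    have s: "1 \<le> s" "S \<le> s" "T\<^sub>1 + 1 \<le> s" "c / \<mu> \<le> s" using tT by (auto simp: T_def s_def)
    define k where "k = s powr (-2/9)"
    have kp: "k ^ n = s powr (- (2 * real n / 9))" if "n > 0" for n
      using s that powr_power[of s "-2/9" n] by (simp add: k_def mult.commute)
    have k: "0 < k" "k \<le> 1"
      using s powr_mono[of "-2/9" 0 s] by (auto simp: k_def)
    have k9: "k ^ 9 = 1 / s\<^sup>2" using kp[of 9] s by (simp add: powr_minus_divide powr_numeral)
    have k3: "1 / k ^ 3 = s powr (2/3)" using kp[of 3] s by (simp add: powr_minus_divide)
    have k2: "k\<^sup>2 = s powr (-4/9)" using kp[of 2] by simp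
    have "(2 * \<bar>t\<bar> + 1 + \<bar>a\<bar> + C) * k ^ 9 \<le> \<mu>"
    proof -
      have "1 * (1 + \<bar>a\<bar> + C) \<le> s * (1 + \<bar>a\<bar> + C)" using s(1) C_nonneg by (intro mult_right_mono) auto
      then have "2 * s + 1 + \<bar>a\<bar> + C \<le> c * s" by (simp add: c_def algebra_simps)
      also have "\<dots> \<le> \<mu> * s * s" using s(1,4) \<mu> by (intro mult_right_mono) (auto simp: field_simps)
      finally show ?thesis using s(1) by (simp add: k9 s_def[symmetric] pos_divide_le_eq power2_eq_square mult_ac)
    qed
    moreover have "t\<^sup>2 * k ^ 9 = 1" using s(1) by (simp add: k9) (simp add: s_def)
    moreover have "T\<^sub>1 + 1 \<le> \<bar>t\<bar>" using s(3) by (simp add: s_def)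
    moreover have "\<mu> \<le> 1/2" using \<mu> by simp
    ultimately have "\<bar>y t / k ^ 3 - 1\<bar> \<le> 1478 * (2 * \<mu> + 768 * \<mu> + 64 * C\<^sub>4 * pi / \<mu> * k\<^sup>2)"
      by (intro approx_solution_close_to_scale[OF ap above k _ _ tR _ _ \<mu>(1,2)]) auto
    also have "y t / k ^ 3 = y t * (1 / k ^ 3)" by simp
    also have "\<dots> = y t * \<bar>t\<bar> powr (2/3)" unfolding k3 s_def ..
    also have "1478 * (2 * \<mu> + 768 * \<mu> + 64 * C\<^sub>4 * pi / \<mu> * k\<^sup>2) \<le> \<eta>"
      using S[OF s(2)] \<mu>(3) by (simp add: G_def[symmetric] k2)
    finally show "\<bar>y t * \<bar>t\<bar> powr (2/3) - 1\<bar> \<le> \<eta>" .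
  qed
qed

end

section \<open>Passage to the whole line\<close>

context coercive_profile
begin

text \<open>
  A solution on \<open>[-R, R]\<close> is determined, with continuous dependence, by its jet at \<open>0\<close>, and these
  jets are bounded in \<open>\<real>\<^sup>3\<close>. Along a convergent subsequence of jets the solutions therefore converge locally
  uniformly by Gronwall's inequality, and the uniform lower bounds and asymptotics pass to the limit.
\<close>

lemma global_solution_exists:
  obtains y y1 y2 where "derivs3_on UNIV y y1 y2 (\<lambda>t. t\<^sup>2 + a - 1 / y t ^ 3)" "\<And>t. 0 < y t"
    "\<And>\<eta>. 0 < \<eta> \<Longrightarrow> \<exists>T. \<forall>t. T \<le> \<bar>t\<bar> \<longrightarrow> \<bar>y t * \<bar>t\<bar> powr (2/3) - 1\<bar> \<le> \<eta>"
proof -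
  have "\<forall>n. \<exists>\<delta> y y1 y2. approx_solution (real n + 1) \<delta> y y1 y2 \<and> (\<forall>t. \<bar>t\<bar> \<le> real n + 1 \<longrightarrow> \<delta> \<le> y t)"
    using untruncated_solution_exists[of "real n + 1" for n] by (metis le_add_same_cancel2 of_nat_0_le_iff)
  then obtain \<delta> Y Y1 Y2 where ap: "\<And>n. approx_solution (real n + 1) (\<delta> n) (Y n) (Y1 n) (Y2 n)"
    and above: "\<And>n t. \<bar>t\<bar> \<le> real n + 1 \<Longrightarrow> \<delta> n \<le> Y n t"
    by metis
  define Z where "Z = (\<lambda>n t. (Y n t, Y1 n t, Y2 n t))"
  obtain M where M: "0 < M"
    "\<And>R \<delta> y y1 y2 t. approx_solution R \<delta> y y1 y2 \<Longrightarrow> 1 \<le> R \<Longrightarrow> \<bar>t\<bar> \<le> 1 \<Longrightarrow>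
       \<bar>y t\<bar> \<le> M \<and> \<bar>y1 t\<bar> \<le> M \<and> \<bar>y2 t\<bar> \<le> M"
    using local_derivative_bounds[of 1] by (metis order.refl)
  have "norm (Z n 0) \<le> 3 * M" for n
    using norm_triple_le[of "Y n 0" "Y1 n 0" "Y2 n 0"] M(2)[OF ap[of n], of 0] by (simp add: Z_def)
  then have "bounded (range (\<lambda>n. Z n 0))" by (auto simp: bounded_iff)
  then obtain \<zeta> r where r: "strict_mono r" and lim0: "((\<lambda>n. Z n 0) \<circ> r) \<longlonglongrightarrow> \<zeta>"
    using bounded_imp_convergent_subsequence by blast
  have rn: "n \<le> r n" for n using seq_suble[OF r] .
  have cauchy0: "Cauchy (\<lambda>n. Z (r n) 0)" using lim0 by (simp add: LIMSEQ_imp_Cauchy o_def)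
  have ex: "\<exists>\<epsilon>>0. \<forall>n t. T \<le> real n + 1 \<longrightarrow> \<bar>t\<bar> \<le> T \<longrightarrow> \<epsilon> \<le> Y n t" if T: "1 \<le> T" for T
  proof -
    obtain \<epsilon> where "0 < \<epsilon>"
      and \<epsilon>: "\<And>R \<delta> y y1 y2 t. approx_solution R \<delta> y y1 y2 \<Longrightarrow> T \<le> R \<Longrightarrow>
       \<delta> \<le> \<epsilon> \<or> (\<forall>t. \<bar>t\<bar> \<le> R \<longrightarrow> \<delta> \<le> y t) \<Longrightarrow> \<bar>t\<bar> \<le> T \<Longrightarrow> \<epsilon> \<le> y t"
      by (rule local_lower_bound[OF T]) (rule that)
    then show ?thesis using ap above by blast
  qed
  have dY: "derivs3_on {-T..T} (Y n) (Y1 n) (Y2 n) (\<lambda>t. t\<^sup>2 + a - reg_cube \<epsilon> (Y n t))"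
    if "T \<le> real n + 1" "\<And>t. \<bar>t\<bar> \<le> T \<Longrightarrow> \<epsilon> \<le> Y n t" for T n \<epsilon>
  proof -
    have "derivs3_on {-T..T} (Y n) (Y1 n) (Y2 n) (\<lambda>t. t\<^sup>2 + a - reg_cube (\<delta> n) (Y n t))"
      using ap[of n] that(1) unfolding approx_solution_def by (auto elim!: derivs3_on_subset)
    moreover have "reg_cube (\<delta> n) (Y n t) = reg_cube \<epsilon> (Y n t)" if "t \<in> {-T..T}" for t
      using above[of t n] \<open>T \<le> real n + 1\<close> \<open>\<And>t. \<bar>t\<bar> \<le> T \<Longrightarrow> \<epsilon> \<le> Y n t\<close>[of t] that
      by (simp add: reg_cube_eq abs_le_iff)
    ultimately show ?thesis unfolding derivs3_on_def by simp
  qed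
  have stable: "\<exists>c>0. \<forall>m n t. T \<le> real m + 1 \<longrightarrow> T \<le> real n + 1 \<longrightarrow> \<bar>t\<bar> \<le> T \<longrightarrow>
      norm (Z m t - Z n t) \<le> c * norm (Z m 0 - Z n 0)" if T: "1 \<le> T" for T
  proof -
    obtain \<epsilon> where \<epsilon>: "0 < \<epsilon>" "\<And>n t. T \<le> real n + 1 \<Longrightarrow> \<bar>t\<bar> \<le> T \<Longrightarrow> \<epsilon> \<le> Y n t" using ex[OF T] by blast
    define L where "L = 3 / \<epsilon> ^ 4"
    have L: "0 \<le> L" using \<epsilon> by (simp add: L_def)
    have "norm (Z m t - Z n t) \<le> exp ((2 + L) * T) * norm (Z m 0 - Z n 0)"
      if mn: "T \<le> real m + 1" "T \<le> real n + 1" and t: "\<bar>t\<bar> \<le> T" for m n t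
    proof -
      have "norm (Z m t - Z n t) \<le> exp ((2 + L) * \<bar>t - 0\<bar>) * norm (Z m 0 - Z n 0)"
        unfolding Z_def diff_Pair
      proof (rule third_order_gronwall[OF dY dY, OF mn(1) _ mn(2)])
        show "\<epsilon> \<le> Y m t" "\<epsilon> \<le> Y n t" if "\<bar>t\<bar> \<le> T" for t using \<epsilon>(2) mn that by auto
        show "\<bar>t\<^sup>2 + a - reg_cube \<epsilon> (Y m t) - (t\<^sup>2 + a - reg_cube \<epsilon> (Y n t))\<bar> \<le> L * \<bar>Y m t - Y n t\<bar>" for t
          using reg_cube_lipschitz[OF \<epsilon>(1), of "Y n t" "Y m t"] by (simp add: L_def abs_minus_commute)
      qed (use L t T in \<open>auto simp: abs_le_iff\<close>)
      also have "\<dots> \<le> exp ((2 + L) * T) * norm (Z m 0 - Z n 0)"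
        using t L by (intro mult_right_mono) (auto intro!: mult_left_mono)
      finally show ?thesis .
    qed
    then show ?thesis by (intro exI[of _ "exp ((2 + L) * T)"]) auto
  qed
  have "convergent (\<lambda>n. Z (r n) t)" for t
    unfolding Cauchy_convergent_iff[symmetric]
  proof (rule metric_CauchyI)
    define T where "T = \<bar>t\<bar> + 1"
    obtain c where c: "0 < c" "\<And>m n. T \<le> real m + 1 \<Longrightarrow> T \<le> real n + 1 \<Longrightarrow>
        norm (Z m t - Z n t) \<le> c * norm (Z m 0 - Z n 0)"
      using stable[of T] by (auto simp: T_def)
    obtain N :: nat where N: "T \<le> real N" using real_arch_simple by blast
    fix e :: real assume "0 < e"
    then obtain K where K: "\<And>m n. K \<le> m \<Longrightarrow> K \<le> n \<Longrightarrow> dist (Z (r m) 0) (Z (r n) 0) < e / c"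
      using metric_CauchyD[OF cauchy0, of "e / c"] c(1) by (auto simp: zero_less_divide_iff)
    show "\<exists>K. \<forall>m\<ge>K. \<forall>n\<ge>K. dist (Z (r m) t) (Z (r n) t) < e"
    proof (intro exI allI impI)
      fix m n assume mn: "max K N \<le> m" "max K N \<le> n"
      then have "T \<le> real (r m) + 1" "T \<le> real (r n) + 1" using N rn[of m] rn[of n] by linarith+
      then have "dist (Z (r m) t) (Z (r n) t) \<le> c * dist (Z (r m) 0) (Z (r n) 0)"
        using c(2) by (simp add: dist_norm)
      also have "\<dots> < c * (e / c)" using K[of m n] mn c(1) by (intro mult_strict_left_mono) auto
      finally show "dist (Z (r m) t) (Z (r n) t) < e" using c(1) by simp
    qed
  qed
  then obtain z where lim: "\<And>t. (\<lambda>n. Z (r n) t) \<longlonglongrightarrow> z t" unfolding convergent_def by metis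
  define y where "y = (\<lambda>t. fst (z t))"
  define y1 where "y1 = (\<lambda>t. fst (snd (z t)))"
  define y2 where "y2 = (\<lambda>t. snd (snd (z t)))"
  have zy: "z t = (y t, y1 t, y2 t)" for t by (simp add: y_def y1_def y2_def)
  have limY: "(\<lambda>n. Y (r n) t) \<longlonglongrightarrow> y t" for t
    using tendsto_fst[OF lim[of t]] by (simp add: Z_def y_def)
  have large: "eventually (\<lambda>n. T \<le> real (r n) + 1) sequentially" for T
  proof -
    obtain N :: nat where "T \<le> real N" using real_arch_simple by blast
    then show ?thesis unfolding eventually_sequentially
      by (intro exI[of _ N] allI impI) (metis add_increasing2 le_trans of_nat_mono order.trans rn zero_le_one)
  qed
  have low: "\<epsilon> \<le> y t" if "\<And>n. T \<le> real n + 1 \<Longrightarrow> \<epsilon> \<le> Y n t" for T t \<epsilon>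
    by (rule tendsto_lowerbound[OF limY]) (use that large[of T] in \<open>auto elim: eventually_mono\<close>)
  have local: "derivs3_on {-T..T} y y1 y2 (\<lambda>t. t\<^sup>2 + a - 1 / y t ^ 3) \<and> (\<forall>t. \<bar>t\<bar> \<le> T \<longrightarrow> 0 < y t)"
    if T: "1 \<le> T" for T
  proof
    obtain \<epsilon> where \<epsilon>: "0 < \<epsilon>" "\<And>n t. T \<le> real n + 1 \<Longrightarrow> \<bar>t\<bar> \<le> T \<Longrightarrow> \<epsilon> \<le> Y n t" using ex[OF T] by blast
    have y\<epsilon>: "\<epsilon> \<le> y t" if "\<bar>t\<bar> \<le> T" for t by (rule low) (use \<epsilon> that in blast)
    then show "\<forall>t. \<bar>t\<bar> \<le> T \<longrightarrow> 0 < y t" using \<epsilon>(1) by force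
    define L where "L = 3 / \<epsilon> ^ 4"
    have L: "0 \<le> L" using \<epsilon> by (simp add: L_def)
    obtain c where c: "0 < c" "\<And>m n t. T \<le> real m + 1 \<Longrightarrow> T \<le> real n + 1 \<Longrightarrow> \<bar>t\<bar> \<le> T \<Longrightarrow>
        norm (Z m t - Z n t) \<le> c * norm (Z m 0 - Z n 0)"
      using stable[OF T] by blast
    obtain N :: nat where N: "T \<le> real N" using real_arch_simple by blast
    \<comment> \<open>From index \<open>N\<close> on all solutions live on \<open>[-T, T]\<close>.\<close>
    define s where "s = (\<lambda>n. r (n + N))"
    have sT: "T \<le> real (s n) + 1" for n using N rn[of "n + N"] by (simp add: s_def)
    have lims: "(\<lambda>n. Z (s n) t) \<longlonglongrightarrow> z t" for t
      using LIMSEQ_ignore_initial_segment[OF lim[of t], of N] by (simp add: s_def)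
    have unif: "norm (Z (s n) t - z t) \<le> c * norm (Z (s n) 0 - z 0)" if "\<bar>t\<bar> \<le> T" for n t
    proof (rule tendsto_le)
      show "(\<lambda>m. norm (Z (s n) t - Z (s m) t)) \<longlonglongrightarrow> norm (Z (s n) t - z t)"
        by (intro tendsto_intros lims)
      show "(\<lambda>m. c * norm (Z (s n) 0 - Z (s m) 0)) \<longlonglongrightarrow> c * norm (Z (s n) 0 - z 0)"
        by (intro tendsto_intros lims)
      show "\<forall>\<^sub>F m in sequentially. norm (Z (s n) t - Z (s m) t) \<le> c * norm (Z (s n) 0 - Z (s m) 0)"
        using c(2) sT that by simp
    qed simp
    define v where "v = (\<lambda>n t. (Y1 n t, Y2 n t, t\<^sup>2 + a - reg_cube \<epsilon> (Y n t)))"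
    define w where "w = (\<lambda>t. (y1 t, y2 t, t\<^sup>2 + a - reg_cube \<epsilon> (y t)))"
    have vw: "norm (v (s n) t - w t) \<le> (2 + L) * (c * norm (Z (s n) 0 - z 0))" if "\<bar>t\<bar> \<le> T" for n t
    proof -
      have "\<bar>t\<^sup>2 + a - reg_cube \<epsilon> (Y (s n) t) - (t\<^sup>2 + a - reg_cube \<epsilon> (y t))\<bar> \<le> L * \<bar>Y (s n) t - y t\<bar>"
        using reg_cube_lipschitz[OF \<epsilon>(1), of "y t" "Y (s n) t"] by (simp add: L_def abs_minus_commute)
      from norm_jet_derivative_le[OF this L]
      have "norm (v (s n) t - w t) \<le> (2 + L) * norm (Z (s n) t - z t)"
        by (simp add: v_def w_def Z_def zy)
      also have "\<dots> \<le> (2 + L) * (c * norm (Z (s n) 0 - z 0))"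
        using L unif[OF that] by (intro mult_left_mono) auto
      finally show ?thesis .
    qed
    have "\<exists>g. \<forall>t\<in>{-T..T}. (\<lambda>n. Z (s n) t) \<longlonglongrightarrow> g t \<and> (g has_derivative (\<lambda>h. h *\<^sub>R w t)) (at t within {-T..T})"
    proof (rule has_derivative_sequence[where ?x0.0 = 0 and l = "z 0" and f' = "\<lambda>n t h. h *\<^sub>R v (s n) t"])
      fix n t assume "t \<in> {-T..T}"
      then show "(Z (s n) has_derivative (\<lambda>h. h *\<^sub>R v (s n) t)) (at t within {-T..T})"
        using dY[OF sT \<epsilon>(2)[OF sT], of n] unfolding derivs3_on_iff_jet has_vector_derivative_def
        by (simp add: Z_def v_def)
    next
      fix e :: real assume "0 < e"
      have "(\<lambda>n. (2 + L) * (c * norm (Z (s n) 0 - z 0))) \<longlonglongrightarrow> (2 + L) * (c * norm (z 0 - z 0))"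
        by (intro tendsto_intros lims)
      then have "\<forall>\<^sub>F n in sequentially. (2 + L) * (c * norm (Z (s n) 0 - z 0)) < e"
        by (rule order_tendstoD) (use \<open>0 < e\<close> in simp)
      then show "\<forall>\<^sub>F n in sequentially. \<forall>t\<in>{-T..T}. \<forall>h. norm (h *\<^sub>R v (s n) t - h *\<^sub>R w t) \<le> e * norm h"
      proof (rule eventually_mono, intro ballI allI)
        fix n t and h :: real assume e: "(2 + L) * (c * norm (Z (s n) 0 - z 0)) < e" and "t \<in> {-T..T}"
        then have "norm (v (s n) t - w t) \<le> e" using vw[of t n] by (simp add: abs_le_iff)
        then have "\<bar>h\<bar> * norm (v (s n) t - w t) \<le> \<bar>h\<bar> * e" by (intro mult_left_mono) auto
        then show "norm (h *\<^sub>R v (s n) t - h *\<^sub>R w t) \<le> e * norm h"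
          by (simp add: scaleR_right_diff_distrib[symmetric] mult.commute)
      qed
    qed (use T lims in auto)
    then obtain g where g: "\<And>t. t \<in> {-T..T} \<Longrightarrow> (\<lambda>n. Z (s n) t) \<longlonglongrightarrow> g t"
      "\<And>t. t \<in> {-T..T} \<Longrightarrow> (g has_derivative (\<lambda>h. h *\<^sub>R w t)) (at t within {-T..T})" by blast
    have gz: "g t = z t" if "t \<in> {-T..T}" for t using LIMSEQ_unique[OF g(1)[OF that] lims] .
    have "(z has_vector_derivative w t) (at t within {-T..T})" if "t \<in> {-T..T}" for t
      by (rule has_vector_derivative_transform[OF that])
         (use g(2)[OF that] gz in \<open>auto simp: has_vector_derivative_def\<close>)
    moreover have "w t = (y1 t, y2 t, t\<^sup>2 + a - 1 / y t ^ 3)" if "t \<in> {-T..T}" for t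
      using y\<epsilon>[of t] that by (simp add: w_def reg_cube_eq abs_le_iff)
    moreover have "z = (\<lambda>t. (y t, y1 t, y2 t))" by (simp add: zy fun_eq_iff)
    ultimately show "derivs3_on {-T..T} y y1 y2 (\<lambda>t. t\<^sup>2 + a - 1 / y t ^ 3)"
      unfolding derivs3_on_iff_jet by simp
  qed
  show thesis
  proof
    show "0 < y t" for t using local[of "\<bar>t\<bar> + 1"] by simp
    show "derivs3_on UNIV y y1 y2 (\<lambda>t. t\<^sup>2 + a - 1 / y t ^ 3)"
      unfolding derivs3_on_def
    proof
      fix t :: real
      define T where "T = \<bar>t\<bar> + 1"
      have dT: "derivs3_on {-T..T} y y1 y2 (\<lambda>t. t\<^sup>2 + a - 1 / y t ^ 3)" using local[of T] by (simp add: T_def)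
      have tT: "t \<in> {-T..T}" "at t within {-T..T} = at t"
        by (auto simp: T_def abs_le_iff intro!: at_within_Icc_at)
      show "(y has_real_derivative y1 t) (at t) \<and> (y1 has_real_derivative y2 t) (at t) \<and>
          (y2 has_real_derivative t\<^sup>2 + a - 1 / y t ^ 3) (at t)"
        using derivs3_onD[OF dT tT(1)] unfolding tT(2) by blast
    qed
    fix \<eta> :: real assume "0 < \<eta>"
    from approx_solution_asymptotics[OF this]
    obtain T where T: "\<And>R \<delta> y y1 y2 t. approx_solution R \<delta> y y1 y2 \<Longrightarrow> (\<And>t. \<bar>t\<bar> \<le> R \<Longrightarrow> \<delta> \<le> y t) \<Longrightarrow>
       T \<le> \<bar>t\<bar> \<Longrightarrow> \<bar>t\<bar> + 1 \<le> R \<Longrightarrow> \<bar>y t * \<bar>t\<bar> powr (2/3) - 1\<bar> \<le> \<eta>"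
      by blast
    show "\<exists>T. \<forall>t. T \<le> \<bar>t\<bar> \<longrightarrow> \<bar>y t * \<bar>t\<bar> powr (2/3) - 1\<bar> \<le> \<eta>"
    proof (intro exI allI impI)
      fix t assume t: "T \<le> \<bar>t\<bar>"
      show "\<bar>y t * \<bar>t\<bar> powr (2/3) - 1\<bar> \<le> \<eta>"
      proof (rule tendsto_upperbound)
        show "(\<lambda>n. \<bar>Y (r n) t * \<bar>t\<bar> powr (2/3) - 1\<bar>) \<longlonglongrightarrow> \<bar>y t * \<bar>t\<bar> powr (2/3) - 1\<bar>"
          by (intro tendsto_intros limY)
        show "\<forall>\<^sub>F n in sequentially. \<bar>Y (r n) t * \<bar>t\<bar> powr (2/3) - 1\<bar> \<le> \<eta>"
          using large[of "\<bar>t\<bar> + 1"] by (rule eventually_mono) (rule T[OF ap above t])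
      qed simp
    qed
  qed
qed

end

lemma derivs3_on_reflect:
  assumes "derivs3_on UNIV y y1 y2 y3"
  shows "derivs3_on UNIV (\<lambda>x. y (- x)) (\<lambda>x. - y1 (- x)) (\<lambda>x. y2 (- x)) (\<lambda>x. - y3 (- x))"
proof -
  have m: "(uminus has_real_derivative -1) (at x)" for x :: real by (auto intro!: derivative_eq_intros)
  note d = derivs3_onD[OF assms UNIV_I]
  show ?thesis
    unfolding derivs3_on_def
    using DERIV_chain2[OF d(1) m] DERIV_minus[OF DERIV_chain2[OF d(2) m]] DERIV_chain2[OF d(3) m] by simp
qed

lemma asymp_equiv_from_product:
  fixes H :: "real \<Rightarrow> real"
  assumes "\<And>\<eta>. 0 < \<eta> \<Longrightarrow> \<exists>T. \<forall>x. T \<le> \<bar>x\<bar> \<longrightarrow> \<bar>H x * \<bar>x\<bar> powr p - 1\<bar> \<le> \<eta>"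
  shows "H \<sim>[at_top] (\<lambda>x. 1 / \<bar>x\<bar> powr p)" "H \<sim>[at_bot] (\<lambda>x. 1 / \<bar>x\<bar> powr p)"
proof -
  have *: "((\<lambda>x. H x * \<bar>x\<bar> powr p) \<longlongrightarrow> 1) F"
    if F: "\<And>T. eventually (\<lambda>x::real. T \<le> \<bar>x\<bar>) F" for F
    unfolding tendsto_iff
  proof (intro allI impI)
    fix e :: real assume "0 < e"
    then obtain T where "\<And>x. T \<le> \<bar>x\<bar> \<Longrightarrow> \<bar>H x * \<bar>x\<bar> powr p - 1\<bar> \<le> e / 2" using assms[of "e / 2"] by auto
    then show "\<forall>\<^sub>F x in F. dist (H x * \<bar>x\<bar> powr p) 1 < e"
      using \<open>0 < e\<close> by (intro eventually_mono[OF F[of T]]) (fastforce simp: dist_real_def)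
  qed
  have "eventually (\<lambda>x. T \<le> \<bar>x\<bar>) at_top" for T :: real
    using eventually_ge_at_top[of T] by eventually_elim simp
  from *[OF this] show "H \<sim>[at_top] (\<lambda>x. 1 / \<bar>x\<bar> powr p)" by (intro asymp_equivI') simp
  have "eventually (\<lambda>x. T \<le> \<bar>x\<bar>) at_bot" for T :: real
    using eventually_le_at_bot[of "- T"] by eventually_elim simp
  from *[OF this] show "H \<sim>[at_bot] (\<lambda>x. 1 / \<bar>x\<bar> powr p)" by (intro asymp_equivI') simp
qed

section \<open>The global solution\<close>

theorem theorem1p1:
  fixes a :: real
  shows "\<exists>H :: real \<Rightarrow> real. is_global_solution a H
           \<and> H \<sim>[at_top] (\<lambda>\<xi>. 1 / \<bar>\<xi>\<bar> powr (2/3))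
           \<and> H \<sim>[at_bot] (\<lambda>\<xi>. 1 / \<bar>\<xi>\<bar> powr (2/3))"
proof -
  obtain h h1 h2 h3 C where prof: "derivs3_on UNIV h h1 h2 h3" "continuous_on UNIV h3" "\<And>t. 0 < h t" "\<And>t. \<bar>h3 t\<bar> \<le> C"
    "\<And>t. \<bar>1 / h t ^ 3 - t\<^sup>2\<bar> \<le> C" "\<And>t. 1 \<le> t\<^sup>2 + a - h3 t"
    by (rule comparison_profile_exists[of a]) (rule that)
  interpret comparison_profile a C h h1 h2 h3 by unfold_locales (rule prof)+
  obtain T\<^sub>1 C\<^sub>4 where far: "0 \<le> C\<^sub>4"
    "\<And>\<delta> t y. admissible \<delta> t \<Longrightarrow> 0 \<le> energy \<delta> t y + C\<^sub>4 / (1 + t\<^sup>2)"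
    "\<And>\<delta> t y. admissible \<delta> t \<Longrightarrow> T\<^sub>1 \<le> \<bar>t\<bar> \<Longrightarrow> gap \<delta> t y \<le> 2 * (energy \<delta> t y + C\<^sub>4 / (1 + t\<^sup>2))"
    by (rule energy_controls_gap_far) (rule that)
  interpret coercive_profile a C h h1 h2 h3 T\<^sub>1 C\<^sub>4 by unfold_locales (rule far; assumption)+
  obtain y y1 y2 where y: "derivs3_on UNIV y y1 y2 (\<lambda>t. t\<^sup>2 + a - 1 / y t ^ 3)" "\<And>t. 0 < y t"
    and asym: "\<And>\<eta>. 0 < \<eta> \<Longrightarrow> \<exists>T. \<forall>t. T \<le> \<bar>t\<bar> \<longrightarrow> \<bar>y t * \<bar>t\<bar> powr (2/3) - 1\<bar> \<le> \<eta>"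
    by (rule global_solution_exists) (rule that)
  define H where "H = (\<lambda>\<xi>. y (- \<xi>))"
  note d = derivs3_onD[OF derivs3_on_reflect[OF y(1)] UNIV_I, folded H_def]
  have D: "deriv H = (\<lambda>\<xi>. - y1 (- \<xi>))" "deriv (\<lambda>\<xi>. - y1 (- \<xi>)) = (\<lambda>\<xi>. y2 (- \<xi>))"
    "deriv (\<lambda>\<xi>. y2 (- \<xi>)) = (\<lambda>\<xi>. - ((- \<xi>)\<^sup>2 + a - 1 / y (- \<xi>) ^ 3))"
    by (rule ext, rule DERIV_imp_deriv, rule d)+
  have "is_global_solution a H"
    unfolding is_global_solution_def
  proof (intro conjI allI impI)
    fix k :: nat and \<xi> :: real assume "k < 3"
    then consider "k = 0" | "k = 1" | "k = 2" by linarith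
    then show "((deriv ^^ k) H) differentiable (at \<xi>)"
      by cases (auto simp: D eval_nat_numeral real_differentiable_def intro: d)
  next
    fix \<xi> :: real
    have "(deriv ^^ 3) H \<xi> = - (\<xi>\<^sup>2 + a - 1 / y (- \<xi>) ^ 3)" by (simp add: eval_nat_numeral D)
    then show "((deriv ^^ 3) H \<xi> + \<xi>\<^sup>2 + a) * H \<xi> ^ 3 = 1"
      using y(2)[of "- \<xi>"] by (simp add: H_def)
  qed
  moreover have "\<exists>T. \<forall>x. T \<le> \<bar>x\<bar> \<longrightarrow> \<bar>H x * \<bar>x\<bar> powr (2/3) - 1\<bar> \<le> \<eta>" if "0 < \<eta>" for \<eta>
    using asym[OF that] unfolding H_def by (metis abs_minus_cancel)
  ultimately show ?thesis using asymp_equiv_from_product[of H "2/3"] by blast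
qed

end
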